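(* Let $\mathbb{K}$ be a field of characteristic zero. Given a positive integer $d$ and a permutation $\pi$ of the numbers $\{1,\ldots,\lfloor d/2\rfloor\}$, there exists a standard graded artinian Gorenstein $\mathbb{K}$-algebra with Hilbert series $\sum_{i=0}^d h_i t^i$ such that $$h_{\pi(1)}<h_{\pi(2)}<\dots<h_{\pi(\lfloor d/2\rfloor)}.$$
   Context: A standard graded $\mathbb{K}$-algebra is a quotient $A=R/I=\bigoplus_{i\ge 0}A_i$ of a polynomial ring $R=\mathbb{K}[x_1,\dots,x_n]$ (variables in degree $1$) by a homogeneous ideal $I$. Its Hilbert series is $\sum_{i\ge0}h_it^i$ with $h_i=\dim_{\mathbb{K}}A_i$. It is artinian if its Hilbert series is a polynomial. The socle of $A$ is $\{f\in A : x_if=0 \text{ for all } i\}$, and an artinian algebra $A$ is Gorenstein if its socle is a one-dimensional $\mathbb{K}$-vector space. The Hilbert series being $\sum_{i=0}^d h_it^i$ means the algebra has socle degree $d$ (the largest degree with $A_d\neq 0$). *)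

theory Defs
  imports
    "HOL-Library.Poly_Mapping"
    "HOL-Combinatorics.Permutations"
    "HOL-Computational_Algebra.Polynomial_FPS"
    "HOL-Algebra.QuotRing"
    "HOL-Algebra.Embedded_Algebras"
begin

text \<open>
  A monomial is a finitely supported exponent vector \<^typ>\<open>nat \<Rightarrow>\<^sub>0 nat\<close>, where the exponent at
  \<open>i\<close> is that of the variable \<open>x\<^sub>i\<close>; the variables are numbered from 0. The polynomial ring
  in \<open>n\<close> variables is the subring of the type \<open>'k mpoly\<close> (countably many variables)
  consisting of the polynomials that involve only the variables \<open>x\<^sub>i\<close> with \<open>i < n\<close>.
\<close>

type_synonym 'k mpoly = "(nat \<Rightarrow>\<^sub>0 nat) \<Rightarrow>\<^sub>0 'k"

definition poly_ring :: "nat \<Rightarrow> ('k::field) mpoly ring" where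
  "poly_ring n =
    \<lparr>carrier = {p. \<forall>m \<in> Poly_Mapping.keys p. Poly_Mapping.keys m \<subseteq> {..<n}},
     mult = (*), one = 1, zero = 0, add = (+)\<rparr>"

definition const :: "'k::field \<Rightarrow> 'k mpoly" where
  "const c = Poly_Mapping.single 0 c"

definition var :: "nat \<Rightarrow> ('k::field) mpoly" where
  "var i = Poly_Mapping.single (Poly_Mapping.single i 1) 1"

definition mdeg :: "(nat \<Rightarrow>\<^sub>0 nat) \<Rightarrow> nat" where
  "mdeg m = (\<Sum>i \<in> Poly_Mapping.keys m. Poly_Mapping.lookup m i)"

text \<open>The homogeneous forms of degree \<open>i\<close>, including 0.\<close>

definition forms :: "nat \<Rightarrow> nat \<Rightarrow> ('k::field) mpoly set" where
  "forms n i = {p \<in> carrier (poly_ring n). \<forall>m \<in> Poly_Mapping.keys p. mdeg m = i}"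

definition homogeneous_ideal :: "nat \<Rightarrow> ('k::field) mpoly set \<Rightarrow> bool" where
  "homogeneous_ideal n I \<longleftrightarrow> (\<exists>S \<subseteq> (\<Union>i. forms n i). I = Idl\<^bsub>poly_ring n\<^esub> S)"

text \<open>
  A standard graded algebra \<open>A = R / I\<close> is represented by the pair of the number \<open>n\<close> of
  variables and the homogeneous ideal \<open>I\<close>. The elements of \<open>A\<close> are cosets of \<open>I\<close>, and
  \<open>proj n I\<close> is the quotient map.
\<close>

abbreviation quot_alg :: "nat \<Rightarrow> ('k::field) mpoly set \<Rightarrow> 'k mpoly set ring" where
  "quot_alg n I \<equiv> poly_ring n Quot I"

definition proj :: "nat \<Rightarrow> ('k::field) mpoly set \<Rightarrow> 'k mpoly \<Rightarrow> 'k mpoly set" where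
  "proj n I f = I +>\<^bsub>poly_ring n\<^esub> f"

text \<open>
  The image of \<open>K\<close> in \<open>A\<close>; it is a subfield of \<open>A\<close> when \<open>A\<close> is not the zero ring. Dimensions
  of subspaces of \<open>A\<close> are taken over it.
\<close>

definition scalars :: "nat \<Rightarrow> ('k::field) mpoly set \<Rightarrow> 'k mpoly set set" where
  "scalars n I = proj n I ` range const"

definition graded_piece :: "nat \<Rightarrow> ('k::field) mpoly set \<Rightarrow> nat \<Rightarrow> 'k mpoly set set" where
  "graded_piece n I i = proj n I ` forms n i"

definition hilbert_function :: "nat \<Rightarrow> ('k::field) mpoly set \<Rightarrow> nat \<Rightarrow> nat" where
  "hilbert_function n I i = ring.dim (quot_alg n I) (scalars n I) (graded_piece n I i)"

definition hilbert_series :: "nat \<Rightarrow> ('k::field) mpoly set \<Rightarrow> nat fps" where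
  "hilbert_series n I = Abs_fps (hilbert_function n I)"

definition artinian :: "nat \<Rightarrow> ('k::field) mpoly set \<Rightarrow> bool" where
  "artinian n I \<longleftrightarrow> (\<exists>p. hilbert_series n I = fps_of_poly p)"

definition socle :: "nat \<Rightarrow> ('k::field) mpoly set \<Rightarrow> 'k mpoly set set" where
  "socle n I = {f \<in> carrier (quot_alg n I).
     \<forall>i<n. proj n I (var i) \<otimes>\<^bsub>quot_alg n I\<^esub> f = \<zero>\<^bsub>quot_alg n I\<^esub>}"

definition artinian_gorenstein :: "nat \<Rightarrow> ('k::field) mpoly set \<Rightarrow> bool" where
  "artinian_gorenstein n I \<longleftrightarrow>
     artinian n I \<and> ring.dimension (quot_alg n I) 1 (scalars n I) (socle n I)"

definition has_socle_degree :: "nat \<Rightarrow> ('k::field) mpoly set \<Rightarrow> nat \<Rightarrow> bool" where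
  "has_socle_degree n I d \<longleftrightarrow>
     graded_piece n I d \<noteq> {\<zero>\<^bsub>quot_alg n I\<^esub>} \<and>
     (\<forall>i>d. graded_piece n I i = {\<zero>\<^bsub>quot_alg n I\<^esub>})"

lemma poly_ring_simps:
  "mult (poly_ring n) = (*)" "one (poly_ring n) = 1"
  "zero (poly_ring n) = 0" "add (poly_ring n) = (+)"
  by (simp_all add: poly_ring_def)

lemma cring_poly_ring: "cring (poly_ring n :: ('k::field) mpoly ring)"
proof (rule cringI)
  show "abelian_group (poly_ring n :: 'k mpoly ring)"
  proof (rule abelian_groupI)
    fix x y :: "'k mpoly"
    assume "x \<in> carrier (poly_ring n)" "y \<in> carrier (poly_ring n)"
    then show "x \<oplus>\<^bsub>poly_ring n\<^esub> y \<in> carrier (poly_ring n)"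
      using Poly_Mapping.keys_add[of x y] by (auto simp: poly_ring_def)
  next
    fix x :: "'k mpoly"
    assume "x \<in> carrier (poly_ring n)"
    then show "\<exists>y \<in> carrier (poly_ring n). y \<oplus>\<^bsub>poly_ring n\<^esub> x = \<zero>\<^bsub>poly_ring n\<^esub>"
      by (intro bexI[of _ "- x"]) (auto simp: poly_ring_def)
  qed (auto simp: poly_ring_def add_ac)
  show "Group.comm_monoid (poly_ring n :: 'k mpoly ring)"
  proof (rule comm_monoidI)
    fix x y :: "'k mpoly"
    assume xy: "x \<in> carrier (poly_ring n)" "y \<in> carrier (poly_ring n)"
    show "x \<otimes>\<^bsub>poly_ring n\<^esub> y \<in> carrier (poly_ring n)"
    proof -
      have "Poly_Mapping.keys m \<subseteq> {..<n}" if m: "m \<in> Poly_Mapping.keys (x * y)" for m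
      proof -
        obtain a b where "m = a + b" "a \<in> Poly_Mapping.keys x" "b \<in> Poly_Mapping.keys y"
          using m Poly_Mapping.keys_mult[of x y] by blast
        then show ?thesis
          using xy Poly_Mapping.keys_add[of a b] by (fastforce simp: poly_ring_def)
      qed
      then show ?thesis by (simp add: poly_ring_def)
    qed
  qed (auto simp: poly_ring_def mult_ac)
qed (auto simp: poly_ring_def algebra_simps)

lemma const_carrier: "const c \<in> carrier (poly_ring n)"
  by (simp add: const_def poly_ring_def)

lemma homogeneous_ideal_ideal:
  assumes "homogeneous_ideal n I"
  shows "ideal I (poly_ring n)"
proof -
  interpret cring "poly_ring n :: 'a mpoly ring" by (rule cring_poly_ring)
  obtain S where "S \<subseteq> (\<Union>i. forms n i)" "I = Idl\<^bsub>poly_ring n\<^esub> S"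
    using assms by (auto simp: homogeneous_ideal_def)
  then show ?thesis by (auto simp: forms_def intro!: genideal_ideal)
qed

lemma subfield_const: "subfield (range const) (poly_ring n :: ('k::field) mpoly ring)"
proof -
  interpret cring "poly_ring n :: 'k mpoly ring" by (rule cring_poly_ring)
  have const_simps: "const a * const b = const (a * b)" "const a + const b = const (a + b)"
    "const 0 = 0" "const 1 = 1" for a b :: 'k
    by (simp_all add: const_def mult_single single_add)
  have uminus: "\<ominus>\<^bsub>poly_ring n\<^esub> const a = const (- a)" for a :: 'k
    by (rule minus_equality)
      (simp_all add: const_carrier poly_ring_simps const_simps)
  have "subring (range const) (poly_ring n :: 'k mpoly ring)"
    by (rule subringI)
      (auto simp: const_carrier poly_ring_simps const_simps uminus simp flip: const_simps(4))
  then have sub: "subcring (range const) (poly_ring n :: 'k mpoly ring)"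
    by (rule subcringI')
  have "Units (poly_ring n\<lparr>carrier := range const\<rparr>) = range const - {0 :: 'k mpoly}"
  proof (intro equalityI subsetI)
    fix x :: "'k mpoly"
    assume "x \<in> Units (poly_ring n\<lparr>carrier := range const\<rparr>)"
    then show "x \<in> range const - {0}"
      by (auto simp: Units_def poly_ring_simps)
  next
    fix x :: "'k mpoly"
    assume "x \<in> range const - {0}"
    then obtain a where a: "x = const a" "a \<noteq> 0"
      using const_simps(3) by blast
    then have "const (inverse a) * x = 1" "x * const (inverse a) = 1"
      by (simp_all add: const_simps)
    with a show "x \<in> Units (poly_ring n\<lparr>carrier := range const\<rparr>)"
      unfolding Units_def by (auto simp: poly_ring_simps)
  qed
  with sub show ?thesis
    by (intro subfieldI) (simp_all add: poly_ring_simps)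
qed

lemma subfield_scalars:
  assumes "homogeneous_ideal n I" "1 \<notin> I"
  shows "subfield (scalars n I) (quot_alg n I)"
proof -
  interpret ideal I "poly_ring n" using assms(1) by (rule homogeneous_ideal_ideal)
  have proj_eq: "proj n I = (+>\<^bsub>poly_ring n\<^esub>) I"
    by (simp add: proj_def fun_eq_iff)
  have one: "(1 :: 'a mpoly) \<in> carrier (poly_ring n)"
    by (simp add: poly_ring_def)
  have "\<one>\<^bsub>quot_alg n I\<^esub> \<noteq> \<zero>\<^bsub>quot_alg n I\<^esub>"
    using a_rcos_self[OF one] assms(2)
    by (auto simp: FactRing_def poly_ring_simps)
  then show ?thesis
    unfolding scalars_def proj_eq
    by (intro ring_hom_ring.img_is_subfield(2)[OF rcos_ring_hom_ring] subfield_const)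
qed

end

theory Submission
  imports Defs "HOL-Library.Nat_Bijection"
begin

text \<open>
  A nonzero linear functional \<open>\<phi>\<close> on the forms of degree \<open>d\<close> defines the ideal of all \<open>p\<close> with
  \<open>\<phi>(p q) = 0\<close> for every \<open>q\<close>. The quotient is Gorenstein of socle degree \<open>d\<close>, and \<open>h\<^sub>i\<close> is the
  rank of the pairing of degrees \<open>i\<close> and \<open>d - i\<close> (Macaulay duality, here without derivatives).

  Take the functional dual to a sum of terms \<open>L\<^sub>u\<^bsup>[d-k]\<^esup> y\<^sub>u\<^bsup>[k]\<^esup>\<close>, one new variable \<open>y\<^sub>u\<close> for each \<open>u\<close>,
  where the \<open>L\<^sub>u\<close> are 0/1 linear forms in shared variables that are indexed by the points \<open>u\<close> of a
  grid with \<open>d - k\<close> coordinates. Forms of degree \<open>d - k\<close> separate the \<open>N\<close> points, but those of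
  lower degree span only a negligible fraction of the functions on the grid. Up to that
  error the Hilbert function for \<open>1 \<le> i \<le> d/2\<close> is therefore \<open>N\<close> times \<open>min i (k - 1)\<close>, plus a bump
  of \<open>N\<close> at \<open>i = k\<close> (of \<open>2 N\<close> if \<open>2 k = d\<close>). The vectors \<open>(1,2,\<dots>,k-1,k,k-1,\<dots>,k-1)\<close> with
  \<open>k = 1,\<dots>,d/2\<close> have non-negative combinations of the form "constant plus \<open>w\<close>" for every
  non-negative \<open>w\<close>, so that the order of the \<open>h\<^sub>i\<close> can be prescribed.
\<close>

section \<open>Monomial degrees and linear functionals on polynomials\<close>

lemma poly_mapping_sum_single:
  fixes p :: "'a \<Rightarrow>\<^sub>0 'b::comm_monoid_add"
  shows "p = (\<Sum>m\<in>Poly_Mapping.keys p. Poly_Mapping.single m (Poly_Mapping.lookup p m))"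
proof (rule poly_mapping_eqI)
  fix m
  show "Poly_Mapping.lookup p m =
      Poly_Mapping.lookup (\<Sum>m\<in>Poly_Mapping.keys p. Poly_Mapping.single m (Poly_Mapping.lookup p m)) m"
    by (simp add: lookup_sum lookup_single when_def sum.delta' in_keys_iff)
qed

lemma poly_mapping_add_induct [case_names zero single add]:
  fixes p :: "'a \<Rightarrow>\<^sub>0 'b::comm_monoid_add"
  assumes "P 0" "\<And>m a. P (Poly_Mapping.single m a)" "\<And>p q. P p \<Longrightarrow> P q \<Longrightarrow> P (p + q)"
  shows "P p"
proof -
  have "P (\<Sum>m\<in>A. Poly_Mapping.single m (Poly_Mapping.lookup p m))" if "finite A" for A
    using that by induction (auto intro: assms)
  then show ?thesis
    by (subst poly_mapping_sum_single) simp
qed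

lemma mdeg_superset:
  assumes "finite A" "Poly_Mapping.keys m \<subseteq> A"
  shows "mdeg m = (\<Sum>i\<in>A. Poly_Mapping.lookup m i)"
  unfolding mdeg_def using assms by (intro sum.mono_neutral_left) (auto simp: in_keys_iff)

lemma mdeg_add [simp]: "mdeg (a + b) = mdeg a + mdeg b"
proof -
  let ?A = "Poly_Mapping.keys a \<union> Poly_Mapping.keys b"
  have "mdeg (a + b) = (\<Sum>i\<in>?A. Poly_Mapping.lookup (a + b) i)"
    by (rule mdeg_superset) (use Poly_Mapping.keys_add[of a b] in auto)
  also have "\<dots> = mdeg a + mdeg b"
    by (simp add: lookup_add sum.distrib mdeg_superset[of ?A a] mdeg_superset[of ?A b])
  finally show ?thesis .
qed

lemma mdeg_single [simp]: "mdeg (Poly_Mapping.single i e) = e"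
  by (simp add: mdeg_def)

lemma lookup_le_mdeg: "Poly_Mapping.lookup m i \<le> mdeg m"
proof (cases "i \<in> Poly_Mapping.keys m")
  case True
  then show ?thesis
    unfolding mdeg_def by (intro member_le_sum) auto
qed (simp add: in_keys_iff)

lemma keys_add_nat:
  fixes a b :: "'a \<Rightarrow>\<^sub>0 nat"
  shows "Poly_Mapping.keys (a + b) = Poly_Mapping.keys a \<union> Poly_Mapping.keys b"
  by (auto simp: in_keys_iff lookup_add)

text \<open>Functionals are encoded by their values \<open>w m\<close> on monomials, because
  multiplying the argument by a monomial \<open>a\<close> then merely shifts the weight to
  \<open>\<lambda>m. w (a + m)\<close>.\<close>

definition lin :: "('m \<Rightarrow> 'k) \<Rightarrow> ('m \<Rightarrow>\<^sub>0 'k::comm_semiring_1) \<Rightarrow> 'k" where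
  "lin w p = (\<Sum>m\<in>Poly_Mapping.keys p. Poly_Mapping.lookup p m * w m)"

lemma lin_superset:
  assumes "finite A" "Poly_Mapping.keys p \<subseteq> A"
  shows "lin w p = (\<Sum>m\<in>A. Poly_Mapping.lookup p m * w m)"
  unfolding lin_def using assms by (intro sum.mono_neutral_left) (auto simp: in_keys_iff)

lemma lin_zero [simp]: "lin w 0 = 0"
  by (simp add: lin_def)

lemma lin_single [simp]: "lin w (Poly_Mapping.single m a) = a * w m"
  by (simp add: lin_def)

lemma lin_add [simp]: "lin w (p + q) = lin w p + lin w q"
proof -
  let ?A = "Poly_Mapping.keys p \<union> Poly_Mapping.keys q"
  have "lin w (p + q) = (\<Sum>i\<in>?A. Poly_Mapping.lookup (p + q) i * w i)"
    by (rule lin_superset) (use Poly_Mapping.keys_add[of p q] in auto)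
  also have "\<dots> = lin w p + lin w q"
    by (simp add: lookup_add sum.distrib distrib_right lin_superset[of ?A p] lin_superset[of ?A q])
  finally show ?thesis .
qed

lemma lin_mult: "lin w (p * q) = lin (\<lambda>a. lin (\<lambda>b. w (a + b)) q) p"
  for p q :: "'m::monoid_add \<Rightarrow>\<^sub>0 'k::comm_semiring_1"
proof (induction p rule: poly_mapping_add_induct)
  case (single m a)
  then show ?case
  proof (induction q rule: poly_mapping_add_induct)
    case (add q r)
    then show ?case by (simp add: distrib_left)
  qed (simp_all add: mult_single mult.assoc)
qed (simp_all add: distrib_right)

lemma lin_weight_cong:
  "(\<And>m. m \<in> Poly_Mapping.keys p \<Longrightarrow> w m = w' m) \<Longrightarrow> lin w p = lin w' p"
  by (simp add: lin_def)

lemma lin_weight_zero: "(\<And>m. m \<in> Poly_Mapping.keys p \<Longrightarrow> w m = 0) \<Longrightarrow> lin w p = 0"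
  by (simp add: lin_def)

lemma lin_weight_sum: "lin (\<lambda>m. \<Sum>i\<in>A. w i m) p = (\<Sum>i\<in>A. lin (w i) p)"
  unfolding lin_def by (subst sum.swap) (simp add: sum_distrib_left)

lemma lin_const_mult: "lin w (const a * p) = a * lin w p"
  by (simp add: lin_mult const_def)

section \<open>Dimensions of subspaces of a quotient algebra\<close>

text \<open>Subspaces are kept among polynomials and projected only when a dimension is taken, so
  that functionals that do not vanish on the ideal can be applied to them.\<close>

definition subspace :: "nat \<Rightarrow> ('k::field) mpoly set \<Rightarrow> bool" where
  "subspace n E \<longleftrightarrow> E \<subseteq> carrier (poly_ring n) \<and> 0 \<in> E \<and>
     (\<forall>p\<in>E. \<forall>q\<in>E. p + q \<in> E) \<and> (\<forall>a. \<forall>p\<in>E. const a * p \<in> E)"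

lemma const_minus_one: "const (- 1) * p = - p"
proof -
  have "const (- 1) = (- 1 :: 'a mpoly)"
    by (simp add: const_def flip: single_one single_uminus)
  then show ?thesis by simp
qed

lemma subspace_diff: "subspace n E \<Longrightarrow> p \<in> E \<Longrightarrow> q \<in> E \<Longrightarrow> p - q \<in> E"
  unfolding subspace_def
  by (metis add_uminus_conv_diff const_minus_one)

lemma subspace_kernel:
  "subspace n E \<Longrightarrow> subspace n {p \<in> E. lin w p = 0}"
  by (auto simp: subspace_def lin_const_mult)

lemma carrier_poly_ring: "p \<in> carrier (poly_ring n) \<longleftrightarrow>
    (\<forall>m\<in>Poly_Mapping.keys p. Poly_Mapping.keys m \<subseteq> {..<n})"
  by (simp add: poly_ring_def)

locale quotient_algebra = ideal I "poly_ring n" for n and I :: "('k::field) mpoly set" +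
  assumes homogeneous: "homogeneous_ideal n I" and one_notin: "1 \<notin> I"
begin

sublocale A: ring "quot_alg n I"
  by (rule quotient_is_ring)

lemma subfield_K: "subfield (scalars n I) (quot_alg n I)"
  using homogeneous one_notin by (rule subfield_scalars)

lemma proj_hom: "proj n I \<in> ring_hom (poly_ring n) (quot_alg n I)"
proof -
  have "proj n I = (+>\<^bsub>poly_ring n\<^esub>) I"
    by (simp add: proj_def fun_eq_iff)
  then show ?thesis using rcos_ring_hom by simp
qed

lemma proj_add: "p \<in> carrier (poly_ring n) \<Longrightarrow> q \<in> carrier (poly_ring n) \<Longrightarrow>
    proj n I (p + q) = proj n I p \<oplus>\<^bsub>quot_alg n I\<^esub> proj n I q"
  using ring_hom_add[OF proj_hom, of p q] by (simp add: poly_ring_simps)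

lemma proj_mult: "p \<in> carrier (poly_ring n) \<Longrightarrow> q \<in> carrier (poly_ring n) \<Longrightarrow>
    proj n I (p * q) = proj n I p \<otimes>\<^bsub>quot_alg n I\<^esub> proj n I q"
  using ring_hom_mult[OF proj_hom, of p q] by (simp add: poly_ring_simps)

lemma proj_closed: "p \<in> carrier (poly_ring n) \<Longrightarrow> proj n I p \<in> carrier (quot_alg n I)"
  using ring_hom_closed[OF proj_hom] .

lemma zero_quot: "\<zero>\<^bsub>quot_alg n I\<^esub> = I"
  by (simp add: FactRing_def)

lemma proj_zero_iff: "p \<in> carrier (poly_ring n) \<Longrightarrow> proj n I p = \<zero>\<^bsub>quot_alg n I\<^esub> \<longleftrightarrow> p \<in> I"
  unfolding zero_quot proj_def
  using a_rcos_const[of p] a_rcos_self[of p] by auto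

lemma proj_eq_iff:
  assumes "p \<in> carrier (poly_ring n)" "q \<in> carrier (poly_ring n)"
  shows "proj n I p = proj n I q \<longleftrightarrow> p - q \<in> I"
proof -
  have pq: "p - q \<in> carrier (poly_ring n)"
    using assms Poly_Mapping.keys_diff[of p q] by (fastforce simp: carrier_poly_ring)
  have "proj n I p = proj n I (p - q) \<oplus>\<^bsub>quot_alg n I\<^esub> proj n I q"
    using proj_add[OF pq assms(2)] by simp
  then have "proj n I p = proj n I q \<longleftrightarrow> proj n I (p - q) = \<zero>\<^bsub>quot_alg n I\<^esub>"
    using proj_closed[OF pq] proj_closed[OF assms(2)]
    by (metis A.add.r_cancel_one' A.add.m_comm A.l_zero)
  then show ?thesis using proj_zero_iff[OF pq] by simp
qed

lemma quot_carrier: "carrier (quot_alg n I) = proj n I ` carrier (poly_ring n)"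
  by (auto simp: FactRing_def A_RCOSETS_def' proj_def)

abbreviation A_dim :: "nat \<Rightarrow> 'k mpoly set \<Rightarrow> bool" where
  "A_dim r E \<equiv> A.dimension r (scalars n I) (proj n I ` E)"

text \<open>Dimensions are built up inductively by line extensions; passing from the kernel of a
  functional to the whole space is one such step.\<close>

lemma line_extension_proj:
  assumes E: "subspace n E" and v: "v \<in> E" "lin w v \<noteq> 0"
  shows "proj n I ` E =
    A.line_extension (scalars n I) (proj n I v) (proj n I ` {p \<in> E. lin w p = 0})"
proof (intro equalityI subsetI)
  have Ec: "E \<subseteq> carrier (poly_ring n)" using E by (simp add: subspace_def)
  fix x assume "x \<in> proj n I ` E"
  then obtain p where p: "p \<in> E" "x = proj n I p" by auto
  define a where "a = lin w p / lin w v"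
  define q where "q = p - const a * v"
  have av: "const a * v \<in> E" using E v by (simp add: subspace_def)
  have q: "q \<in> E" unfolding q_def using subspace_diff[OF E p(1) av] .
  have "lin w q = 0"
    using v(2) lin_add[of w q "const a * v"] by (simp add: q_def lin_const_mult a_def)
  moreover have "x = proj n I (const a) \<otimes>\<^bsub>quot_alg n I\<^esub> proj n I v \<oplus>\<^bsub>quot_alg n I\<^esub> proj n I q"
    using proj_add[of "const a * v" q] proj_mult[of "const a" v] Ec av q v(1) p(2)
    by (auto simp: const_carrier q_def subset_eq)
  ultimately show "x \<in> A.line_extension (scalars n I) (proj n I v) (proj n I ` {p \<in> E. lin w p = 0})"
    using q unfolding A.line_extension_mem_iff scalars_def by auto
next
  have Ec: "E \<subseteq> carrier (poly_ring n)" using E by (simp add: subspace_def)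
  fix x assume "x \<in> A.line_extension (scalars n I) (proj n I v) (proj n I ` {p \<in> E. lin w p = 0})"
  then obtain a q where q: "q \<in> E"
    and x: "x = proj n I (const a) \<otimes>\<^bsub>quot_alg n I\<^esub> proj n I v \<oplus>\<^bsub>quot_alg n I\<^esub> proj n I q"
    unfolding A.line_extension_mem_iff scalars_def by auto
  have av: "const a * v \<in> E" using E v by (simp add: subspace_def)
  have "x = proj n I (const a * v + q)"
    using proj_add[of "const a * v" q] proj_mult[of "const a" v] Ec av q v(1) x
    by (auto simp: const_carrier subset_eq)
  moreover have "const a * v + q \<in> E" using E av q by (simp add: subspace_def)
  ultimately show "x \<in> proj n I ` E" by simp
qed

text \<open>As \<open>w\<close> may be nonzero on \<open>I\<close>, the image of \<open>v\<close>
  may already lie in the image of the kernel, and then the dimension does not grow.\<close>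

lemma dim_kernel_cases:
  assumes E: "subspace n E" and r: "A_dim r {p \<in> E. lin w p = 0}"
  shows "A_dim r E \<or> A_dim (Suc r) E"
proof (cases "\<exists>v\<in>E. lin w v \<noteq> 0")
  case True
  then obtain v where v: "v \<in> E" "lin w v \<noteq> 0" by auto
  have vc: "proj n I v \<in> carrier (quot_alg n I)"
    using v E by (auto simp: subspace_def intro: proj_closed)
  let ?F = "proj n I ` {p \<in> E. lin w p = 0}"
  show ?thesis
  proof (cases "proj n I v \<in> ?F")
    case True
    have "proj n I ` E = ?F"
    proof
      show "proj n I ` E \<subseteq> ?F"
        unfolding line_extension_proj[OF E v] A.line_extension_mem_iff
        using A.space_subgroup_props(3,5)[OF subfield_K r] True
        by (auto simp: A.line_extension_mem_iff)
    qed auto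
    then show ?thesis using r by simp
  next
    case False
    then show ?thesis
      unfolding line_extension_proj[OF E v] using A.Suc_dim[OF vc False r] by simp
  qed
next
  case False
  then have "{p \<in> E. lin w p = 0} = E" by auto
  then show ?thesis using r by simp
qed

text \<open>A functional that vanishes on \<open>I\<close> is well defined on the quotient, so it
  keeps \<open>proj n I v\<close> out of the image of its kernel.\<close>

lemma dim_kernel_Suc:
  assumes E: "subspace n E" and r: "A_dim r {p \<in> E. lin w p = 0}"
    and w: "\<And>p. p \<in> I \<Longrightarrow> lin w p = 0" and v: "v \<in> E" "lin w v \<noteq> 0"
  shows "A_dim (Suc r) E"
proof -
  have Ec: "E \<subseteq> carrier (poly_ring n)" using E by (simp add: subspace_def)
  have "proj n I v \<notin> proj n I ` {p \<in> E. lin w p = 0}"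
  proof
    assume "proj n I v \<in> proj n I ` {p \<in> E. lin w p = 0}"
    then obtain p where p: "p \<in> E" "lin w p = 0" "proj n I v = proj n I p" by auto
    then have "v - p \<in> I" using proj_eq_iff Ec v(1) by auto
    then have "lin w (v - p) = 0" by (rule w)
    then show False using v(2) p(2) lin_add[of w "v - p" p] by simp
  qed
  then show ?thesis
    unfolding line_extension_proj[OF E v]
    using A.Suc_dim r proj_closed Ec v(1) by blast
qed

lemma dim_zero:
  assumes "subspace n E" "E \<subseteq> I"
  shows "A_dim 0 E"
proof -
  have "proj n I p = \<zero>\<^bsub>quot_alg n I\<^esub>" if "p \<in> E" for p
    using proj_zero_iff[of p] assms that by (auto simp: subspace_def)
  then have "proj n I ` E = {\<zero>\<^bsub>quot_alg n I\<^esub>}"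
    using assms(1) by (force simp: subspace_def)
  then show ?thesis using A.zero_dim by simp
qed

text \<open>Each member of \<open>W\<close> cuts the dimension by at most one, and the common kernel
  is zero in the quotient. This also shows that \<open>E\<close> has a finite dimension.\<close>

lemma dim_upper:
  assumes "finite W" "subspace n E" "\<And>p. p \<in> E \<Longrightarrow> (\<And>w. w \<in> W \<Longrightarrow> lin w p = 0) \<Longrightarrow> p \<in> I"
  shows "\<exists>r \<le> card W. A_dim r E"
  using assms
proof (induction W arbitrary: E rule: finite_induct)
  case empty
  then have "E \<subseteq> I" by auto
  then show ?case using dim_zero[OF empty(1)] by auto
next
  case (insert w W)
  obtain r where r: "r \<le> card W" "A_dim r {p \<in> E. lin w p = 0}"
    using insert.IH[OF subspace_kernel[OF insert.prems(1)]] insert.prems(2) by blast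
  then show ?case
    using dim_kernel_cases[OF insert.prems(1) r(2)] insert.hyps by (auto intro: le_SucI)
qed

text \<open>The kernel of \<open>f t\<close> still contains \<open>v s\<close> for
  \<open>s \<noteq> t\<close>, so every element of \<open>T\<close> splits off exactly one
  dimension. \<open>W\<close> guarantees that what remains has a finite dimension.\<close>

lemma dim_lower:
  assumes "finite T" "finite W" "subspace n E"
    "\<And>p. p \<in> E \<Longrightarrow> (\<And>w. w \<in> W \<Longrightarrow> lin w p = 0) \<Longrightarrow> p \<in> I"
    "\<And>t. t \<in> T \<Longrightarrow> v t \<in> E" "\<And>t p. t \<in> T \<Longrightarrow> p \<in> I \<Longrightarrow> lin (f t) p = 0"
    "\<And>t. t \<in> T \<Longrightarrow> lin (f t) (v t) \<noteq> 0"
    "\<And>s t. s \<in> T \<Longrightarrow> t \<in> T \<Longrightarrow> s \<noteq> t \<Longrightarrow> lin (f t) (v s) = 0"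
  shows "\<exists>r \<ge> card T. A_dim r E"
  using assms
proof (induction T arbitrary: E rule: finite_induct)
  case empty
  have "\<exists>r\<le>card W. A_dim r E"
    by (rule dim_upper[OF empty(1,2)]) (rule empty(3))
  then show ?case by auto
next
  case (insert t T)
  have "\<exists>r \<ge> card T. A_dim r {p \<in> E. lin (f t) p = 0}"
  proof (rule insert.IH)
    show "subspace n {p \<in> E. lin (f t) p = 0}"
      by (rule subspace_kernel) (rule insert.prems)
    show "v s \<in> {p \<in> E. lin (f t) p = 0}" if "s \<in> T" for s
      using insert.prems(4,7) insert.hyps that by auto
  qed (use insert.prems in auto)
  then obtain r where r: "r \<ge> card T" "A_dim r {p \<in> E. lin (f t) p = 0}"
    by blast
  have "A_dim (Suc r) E"
    by (rule dim_kernel_Suc[OF insert.prems(2) r(2)]) (use insert.prems in auto)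
  then show ?case using r(1) insert.hyps by (intro exI[of _ "Suc r"]) auto
qed

lemma dim_eqI: "A_dim r E \<Longrightarrow> A.dim (scalars n I) (proj n I ` E) = r"
  using A.dimI[OF subfield_K] by (simp add: over_def)

end

section \<open>Homogeneous forms and components\<close>

lemma keys_const_mult: "Poly_Mapping.keys (const a * p) \<subseteq> Poly_Mapping.keys p"
  using Poly_Mapping.keys_mult[of "const a" p] by (auto simp: const_def split: if_splits)

lemma subspace_forms: "subspace n (forms n i :: 'k::field mpoly set)"
  unfolding subspace_def
proof (intro conjI ballI allI)
  show "forms n i \<subseteq> carrier (poly_ring n)" "0 \<in> forms n i"
    by (auto simp: forms_def carrier_poly_ring)
  show "p + q \<in> forms n i" if "p \<in> forms n i" "q \<in> forms n i" for p q :: "'k mpoly"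
    using that Poly_Mapping.keys_add[of p q] by (fastforce simp: forms_def carrier_poly_ring)
  show "const a * p \<in> forms n i" if "p \<in> forms n i" for a and p :: "'k mpoly"
    using that keys_const_mult[of a p] by (fastforce simp: forms_def carrier_poly_ring)
qed

definition hom_component :: "nat \<Rightarrow> 'k::field mpoly \<Rightarrow> 'k mpoly" where
  "hom_component j p =
     (\<Sum>m\<in>{m\<in>Poly_Mapping.keys p. mdeg m = j}. Poly_Mapping.single m (Poly_Mapping.lookup p m))"

lemma lookup_hom_component:
  "Poly_Mapping.lookup (hom_component j p) m = (if mdeg m = j then Poly_Mapping.lookup p m else 0)"
  by (auto simp: hom_component_def lookup_sum lookup_single when_def in_keys_iff)

lemma keys_hom_component:
  "Poly_Mapping.keys (hom_component j p) = {m \<in> Poly_Mapping.keys p. mdeg m = j}"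
  by (auto simp: in_keys_iff lookup_hom_component split: if_splits)

lemma sum_hom_components: "p = (\<Sum>j\<in>mdeg ` Poly_Mapping.keys p. hom_component j p)"
  by (rule poly_mapping_eqI) (auto simp: lookup_sum lookup_hom_component in_keys_iff)

lemma hom_component_form: "p \<in> carrier (poly_ring n) \<Longrightarrow> hom_component j p \<in> forms n j"
  by (auto simp: forms_def carrier_poly_ring keys_hom_component)

lemma lin_hom_component: "lin w (hom_component j p) = lin (\<lambda>m. if mdeg m = j then w m else 0) p"
proof -
  have "lin w (hom_component j p) =
      (\<Sum>m\<in>Poly_Mapping.keys p. Poly_Mapping.lookup (hom_component j p) m * w m)"
    by (rule lin_superset) (auto simp: keys_hom_component)
  then show ?thesis
    by (auto simp: lin_def lookup_hom_component intro!: sum.cong)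
qed

lemma image_eq_singleton_iff: "F \<noteq> {} \<Longrightarrow> f ` F = {z} \<longleftrightarrow> (\<forall>p\<in>F. f p = z)"
  by auto

section \<open>Gorenstein algebras from functionals\<close>

locale dual_functional =
  fixes n d :: nat and c :: "(nat \<Rightarrow>\<^sub>0 nat) \<Rightarrow> 'k::field"
  assumes c_degree: "c m \<noteq> 0 \<Longrightarrow> mdeg m = d"
    and c_vars: "c m \<noteq> 0 \<Longrightarrow> Poly_Mapping.keys m \<subseteq> {..<n}"
    and c_nonzero: "\<exists>m. c m \<noteq> 0"
begin

text \<open>The expression is the value of \<open>lin c\<close> at \<open>p\<close> times the
  monomial \<open>a\<close>; by linearity, monomials suffice as multipliers.\<close>

definition I :: "'k mpoly set" where
  "I = {p \<in> carrier (poly_ring n). \<forall>a. lin (\<lambda>m. c (a + m)) p = 0}"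

lemma lin_I: "p \<in> I \<Longrightarrow> lin (\<lambda>m. c (a + m)) p = 0"
  by (simp add: I_def)

lemma I_carrier: "p \<in> I \<Longrightarrow> p \<in> carrier (poly_ring n)"
  by (simp add: I_def)

lemma I_memI: "p \<in> carrier (poly_ring n) \<Longrightarrow> (\<And>a. lin (\<lambda>m. c (a + m)) p = 0) \<Longrightarrow> p \<in> I"
  by (simp add: I_def)

lemma forms_vanish: "i > d \<Longrightarrow> forms n i \<subseteq> I"
  using c_degree by (fastforce simp: forms_def I_def intro: lin_weight_zero)

lemma I_mult:
  assumes "p \<in> I" "q \<in> carrier (poly_ring n)"
  shows "q * p \<in> I"
proof -
  interpret cring "poly_ring n :: 'k mpoly ring" by (rule cring_poly_ring)
  have "lin (\<lambda>m. c (a + m)) (q * p) = 0" for a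
    unfolding lin_mult by (rule lin_weight_zero) (use assms(1) in \<open>simp add: I_def flip: add.assoc\<close>)
  moreover have "q * p \<in> carrier (poly_ring n)"
    using m_closed[of q p] assms by (simp add: I_def poly_ring_simps)
  ultimately show ?thesis by (simp add: I_def)
qed

lemma subspace_I: "subspace n I"
  unfolding subspace_def
proof (intro conjI ballI allI)
  show "I \<subseteq> carrier (poly_ring n)" "0 \<in> I"
    by (auto simp: I_def carrier_poly_ring)
  show "p + q \<in> I" if "p \<in> I" "q \<in> I" for p q
    using that Poly_Mapping.keys_add[of p q] by (fastforce simp: I_def carrier_poly_ring)
  show "const a * p \<in> I" if "p \<in> I" for a p
    using that I_mult const_carrier by blast
qed

lemma ideal_I: "ideal I (poly_ring n)"
proof -
  interpret R: cring "poly_ring n :: 'k mpoly ring" by (rule cring_poly_ring)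
  show ?thesis
  proof (rule idealI)
    show "ring (poly_ring n :: 'k mpoly ring)" by (rule R.ring_axioms)
    show "subgroup I (add_monoid (poly_ring n))"
    proof (rule R.add.subgroupI)
      show "\<ominus>\<^bsub>poly_ring n\<^esub> p \<in> I" if p: "p \<in> I" for p
      proof -
        have "- p \<in> I"
          using subspace_diff[OF subspace_I _ p, of 0] subspace_I by (simp add: subspace_def)
        moreover have "\<ominus>\<^bsub>poly_ring n\<^esub> p = - p"
          using p calculation
          by (intro R.minus_equality) (auto simp: I_def poly_ring_simps)
        ultimately show ?thesis by simp
      qed
    qed (use subspace_I in \<open>auto simp: subspace_def poly_ring_simps\<close>)
    show "x \<otimes>\<^bsub>poly_ring n\<^esub> a \<in> I" "a \<otimes>\<^bsub>poly_ring n\<^esub> x \<in> I"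
      if "a \<in> I" "x \<in> carrier (poly_ring n)" for a x
      using I_mult[OF that] by (simp_all add: poly_ring_simps mult.commute)
  qed
qed

text \<open>Since \<open>c\<close> lives in degree \<open>d\<close>, the weight shifted by
  \<open>a\<close> sees only the component of degree \<open>d - mdeg a\<close>. Its value on a
  component is therefore its value on \<open>p\<close> or zero.\<close>

lemma hom_component_in_I:
  assumes "p \<in> I"
  shows "hom_component j p \<in> I"
proof -
  have "lin (\<lambda>m. c (a + m)) (hom_component j p) = 0" for a
  proof (cases "mdeg a + j = d")
    case True
    have "lin (\<lambda>m. c (a + m)) (hom_component j p) = lin (\<lambda>m. c (a + m)) p"
      unfolding lin_hom_component using True c_degree by (intro lin_weight_cong) fastforce
    then show ?thesis using assms by (simp add: I_def)
  next
    case False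
    then show ?thesis
      unfolding lin_hom_component using c_degree by (intro lin_weight_zero) fastforce
  qed
  then show ?thesis
    using assms by (auto simp: I_def carrier_poly_ring keys_hom_component)
qed

lemma homogeneous_ideal_I: "homogeneous_ideal n I"
proof -
  interpret R: cring "poly_ring n :: 'k mpoly ring" by (rule cring_poly_ring)
  \<comment> \<open>All homogeneous members of \<open>I\<close> serve as generators; the components
    of any member of \<open>I\<close> are among them.\<close>
  define S where "S = I \<inter> (\<Union>i. forms n i)"
  have S: "S \<subseteq> carrier (poly_ring n)"
    by (auto simp: S_def I_carrier)
  interpret J: ideal "Idl\<^bsub>poly_ring n\<^esub> S" "poly_ring n"
    by (rule R.genideal_ideal[OF S])
  have "p \<in> Idl\<^bsub>poly_ring n\<^esub> S" if p: "p \<in> I" for p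
  proof -
    have "(\<Sum>j\<in>A. hom_component j p) \<in> Idl\<^bsub>poly_ring n\<^esub> S" if "finite A" for A
      using that
    proof induction
      case empty
      then show ?case using J.zero_closed by (simp add: poly_ring_simps)
    next
      case (insert j A)
      have "hom_component j p \<in> S"
        using hom_component_in_I[OF p, of j] hom_component_form[OF I_carrier[OF p], of j]
        unfolding S_def by blast
      then show ?case
        using insert R.genideal_self[OF S] J.a_closed by (auto simp: poly_ring_simps)
    qed
    then show ?thesis
      by (subst sum_hom_components) simp
  qed
  moreover have "Idl\<^bsub>poly_ring n\<^esub> S \<subseteq> I"
    by (rule R.genideal_minimal[OF ideal_I]) (auto simp: S_def)
  ultimately have "I = Idl\<^bsub>poly_ring n\<^esub> S" by blast
  then show ?thesis
    unfolding homogeneous_ideal_def by (intro exI[of _ S]) (auto simp: S_def)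
qed

lemma one_notin_I: "1 \<notin> I"
proof
  assume "1 \<in> I"
  then have "lin (\<lambda>m. c (a + m)) 1 = 0" for a by (simp add: I_def)
  then have "c a = 0" for a
    using lin_single[of "\<lambda>m. c (a + m)" 0 1] by simp
  then show False using c_nonzero by simp
qed

sublocale quotient_algebra n I
  by (intro quotient_algebra.intro ideal_I quotient_algebra_axioms.intro homogeneous_ideal_I one_notin_I)

lemma hilbert_function_vanish: "i > d \<Longrightarrow> hilbert_function n I i = 0"
  unfolding hilbert_function_def graded_piece_def
  by (intro dim_eqI dim_zero subspace_forms forms_vanish)

lemma hilbert_series_I:
  "hilbert_series n I = fps_of_poly (\<Sum>i=0..d. Polynomial.monom (hilbert_function n I i) i)"
proof (rule fps_ext)
  fix i
  show "fps_nth (hilbert_series n I) i =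
      fps_nth (fps_of_poly (\<Sum>i=0..d. Polynomial.monom (hilbert_function n I i) i)) i"
    using hilbert_function_vanish[of i]
    by (auto simp: hilbert_series_def coeff_sum)
qed

lemma graded_piece_zero_iff: "graded_piece n I i = {\<zero>\<^bsub>quot_alg n I\<^esub>} \<longleftrightarrow> forms n i \<subseteq> I"
proof -
  have "forms n i \<subseteq> carrier (poly_ring n)" "0 \<in> forms n i"
    using subspace_forms[of n i] by (auto simp: subspace_def)
  then have "proj n I p = \<zero>\<^bsub>quot_alg n I\<^esub> \<longleftrightarrow> p \<in> I" if "p \<in> forms n i" for p
    using proj_zero_iff[of p] that by auto
  moreover have "graded_piece n I i = {\<zero>\<^bsub>quot_alg n I\<^esub>} \<longleftrightarrow>
      (\<forall>p\<in>forms n i. proj n I p = \<zero>\<^bsub>quot_alg n I\<^esub>)"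
    unfolding graded_piece_def using \<open>0 \<in> forms n i\<close> by (intro image_eq_singleton_iff) auto
  ultimately show ?thesis by (simp add: subset_eq)
qed

lemma nonzero_form:
  assumes "c m \<noteq> 0"
  shows "Poly_Mapping.single m 1 \<in> forms n d" "Poly_Mapping.single m 1 \<notin> I"
    "lin c (Poly_Mapping.single m 1) \<noteq> 0"
proof -
  show "Poly_Mapping.single m 1 \<in> forms n d" "lin c (Poly_Mapping.single m 1) \<noteq> 0"
    using assms c_degree c_vars by (auto simp: forms_def carrier_poly_ring)
  then show "Poly_Mapping.single m 1 \<notin> I"
    using lin_I[of "Poly_Mapping.single m 1" 0] by auto
qed

lemma has_socle_degree_I: "has_socle_degree n I d"
  unfolding has_socle_degree_def graded_piece_zero_iff
  using forms_vanish nonzero_form c_nonzero by blast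

definition socle_reps :: "'k mpoly set" where
  "socle_reps = {p \<in> carrier (poly_ring n). \<forall>i<n. var i * p \<in> I}"

lemma var_carrier: "i < n \<Longrightarrow> var i \<in> carrier (poly_ring n)"
  by (auto simp: var_def carrier_poly_ring)

lemma subspace_socle_reps: "subspace n socle_reps"
proof -
  interpret cring "poly_ring n :: 'k mpoly ring" by (rule cring_poly_ring)
  have "const a * p \<in> carrier (poly_ring n)" if "p \<in> carrier (poly_ring n)" for a :: 'k and p
    using that keys_const_mult[of a p] by (fastforce simp: carrier_poly_ring)
  moreover have "p + q \<in> carrier (poly_ring n)"
    if "p \<in> carrier (poly_ring n)" "q \<in> carrier (poly_ring n)" for p q :: "'k mpoly"
    using a_closed[OF that] by (simp add: poly_ring_simps)
  moreover have "(0 :: 'k mpoly) \<in> carrier (poly_ring n)"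
    using zero_closed by (simp add: poly_ring_simps)
  ultimately show ?thesis
    using subspace_I by (auto simp: subspace_def socle_reps_def distrib_left mult.left_commute)
qed

lemma socle_eq: "socle n I = proj n I ` socle_reps"
proof -
  interpret cring "poly_ring n :: 'k mpoly ring" by (rule cring_poly_ring)
  have "proj n I (var i) \<otimes>\<^bsub>quot_alg n I\<^esub> proj n I p = \<zero>\<^bsub>quot_alg n I\<^esub> \<longleftrightarrow> var i * p \<in> I"
    if "i < n" "p \<in> carrier (poly_ring n)" for i p
    using proj_mult[OF var_carrier that(2)] proj_zero_iff[of "var i * p"]
      m_closed[OF var_carrier that(2)] that by (simp add: poly_ring_simps)
  then show ?thesis
    by (auto simp: socle_def socle_reps_def quot_carrier)
qed

text \<open>A variable of \<open>a \<noteq> 0\<close> can be moved over to \<open>p\<close>, where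
  the product is in \<open>I\<close>; if it is not among the first \<open>n\<close> variables,
  \<open>c\<close> is zero anyway. This leaves \<open>a = 0\<close>, which is the assumption
  \<open>lin c p = 0\<close>.\<close>

lemma socle_kernel:
  assumes p: "p \<in> socle_reps" "lin c p = 0"
  shows "p \<in> I"
proof -
  have "lin (\<lambda>m. c (a + m)) p = 0" for a
  proof (cases "a = 0")
    case False
    then obtain i where i: "i \<in> Poly_Mapping.keys a" by fastforce
    define b where "b = a - Poly_Mapping.single i 1"
    have a: "a = b + Poly_Mapping.single i 1"
      using i by (intro poly_mapping_eqI)
        (auto simp: b_def lookup_add lookup_minus lookup_single when_def in_keys_iff)
    show ?thesis
    proof (cases "i < n")
      case True
      then have "lin (\<lambda>m. c (b + m)) (var i * p) = 0"
        using p(1) by (intro lin_I) (simp add: socle_reps_def)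
      then show ?thesis
        by (simp add: lin_mult var_def a add.assoc)
    next
      case False
      have "c (a + m) = 0" for m
        using c_vars[of "a + m"] i False by (auto simp: keys_add_nat)
      then show ?thesis by (simp add: lin_def)
    qed
  qed (use p in simp)
  then show ?thesis using p(1) by (intro I_memI) (simp_all add: socle_reps_def)
qed

text \<open>On the socle the kernel of \<open>lin c\<close> is zero by \<open>socle_kernel\<close>,
  so the dimension is at most one. A monomial with \<open>c m \<noteq> 0\<close> lies in the socle,
  because its multiples by variables have degree \<open>d + 1\<close>.\<close>

lemma artinian_gorenstein_I: "artinian_gorenstein n I"
proof -
  obtain m where m: "c m \<noteq> 0" using c_nonzero by auto
  have "A_dim 0 {p \<in> socle_reps. lin c p = 0}"
    by (rule dim_zero) (auto intro: subspace_kernel subspace_socle_reps socle_kernel)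
  moreover have "Poly_Mapping.single m 1 \<in> socle_reps"
  proof -
    have "var i * Poly_Mapping.single m (1 :: 'k) \<in> I" if "i < n" for i
      using forms_vanish[of "Suc d"] c_degree[OF m] c_vars[OF m] that
      by (auto simp: var_def mult_single forms_def carrier_poly_ring keys_add_nat subset_eq)
    then show ?thesis
      using nonzero_form(1)[OF m] by (auto simp: socle_reps_def forms_def)
  qed
  ultimately have "A_dim (Suc 0) socle_reps"
    using lin_I[of _ 0] nonzero_form(3)[OF m]
    by (intro dim_kernel_Suc[OF subspace_socle_reps, where w = c]) auto
  then show ?thesis
    unfolding artinian_gorenstein_def socle_eq artinian_def using hilbert_series_I by auto
qed

text \<open>The monomials \<open>u t\<close> are independent modulo \<open>I\<close>, since pairing
  them with the \<open>v t\<close> gives a diagonal matrix with nonzero diagonal.\<close>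

lemma hilbert_function_bounds:
  assumes "finite T" "finite W"
    and W: "\<And>p. p \<in> forms n i \<Longrightarrow> (\<And>w. w \<in> W \<Longrightarrow> lin w p = 0) \<Longrightarrow> p \<in> I"
    and u: "\<And>t. t \<in> T \<Longrightarrow> mdeg (u t) = i" "\<And>t. t \<in> T \<Longrightarrow> c (v t + u t) \<noteq> 0"
    and uv: "\<And>s t. s \<in> T \<Longrightarrow> t \<in> T \<Longrightarrow> s \<noteq> t \<Longrightarrow> c (v t + u s) = 0"
  shows "card T \<le> hilbert_function n I i" "hilbert_function n I i \<le> card W"
proof -
  have "\<exists>r \<ge> card T. A_dim r (forms n i)"
  proof (rule dim_lower[where v = "\<lambda>t. Poly_Mapping.single (u t) 1"
        and f = "\<lambda>t m. c (v t + m)", OF assms(1,2) subspace_forms W])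
    show "Poly_Mapping.single (u t) 1 \<in> forms n i" if "t \<in> T" for t
      using u[OF that] c_vars[OF u(2)[OF that]] by (auto simp: forms_def carrier_poly_ring keys_add_nat)
  qed (use lin_I u uv in auto)
  then obtain r where r: "r \<ge> card T" "A_dim r (forms n i)" by blast
  obtain r' where r': "r' \<le> card W" "A_dim r' (forms n i)"
    using dim_upper[OF assms(2) subspace_forms W] by blast
  have "hilbert_function n I i = r" "hilbert_function n I i = r'"
    unfolding hilbert_function_def graded_piece_def using dim_eqI r(2) r'(2) by blast+
  then show "card T \<le> hilbert_function n I i" "hilbert_function n I i \<le> card W"
    using r(1) r'(1) by auto
qed

end

section \<open>Supports and square-free monomials\<close>

lemma card_keys_le_mdeg: "card (Poly_Mapping.keys m) \<le> mdeg m"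
proof -
  have "(\<Sum>i\<in>Poly_Mapping.keys m. 1) \<le> mdeg m"
    unfolding mdeg_def by (rule sum_mono) (simp add: in_keys_iff Suc_le_eq)
  then show ?thesis by simp
qed

definition sqfree :: "nat set \<Rightarrow> (nat \<Rightarrow>\<^sub>0 nat)" where
  "sqfree S = (\<Sum>x\<in>S. Poly_Mapping.single x 1)"

lemma lookup_sqfree: "finite S \<Longrightarrow> Poly_Mapping.lookup (sqfree S) x = of_bool (x \<in> S)"
  by (simp add: sqfree_def lookup_sum lookup_single when_def)

lemma keys_sqfree: "finite S \<Longrightarrow> Poly_Mapping.keys (sqfree S) = S"
  by (auto simp: in_keys_iff lookup_sqfree)

lemma mdeg_sqfree: "finite S \<Longrightarrow> mdeg (sqfree S) = card S"
  by (simp add: mdeg_def keys_sqfree lookup_sqfree)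

section \<open>Indicator vectors as point configurations\<close>

text \<open>Each \<open>u\<close> stands for one summand: \<open>X u\<close> holds the variables of
  its linear form and \<open>y u\<close> is its private variable. The size of \<open>X u\<close>
  makes the product of its variables a monomial of degree \<open>d - k u\<close>, the degree in
  which the points are separated.\<close>

locale point_config =
  fixes n d :: nat and U :: "'u set" and k :: "'u \<Rightarrow> nat" and X :: "'u \<Rightarrow> nat set" and y :: "'u \<Rightarrow> nat"
  assumes finite_U: "finite U" and U_nonempty: "U \<noteq> {}"
    and k_pos: "u \<in> U \<Longrightarrow> 1 \<le> k u" and k_le: "u \<in> U \<Longrightarrow> 2 * k u \<le> d"
    and finite_X: "u \<in> U \<Longrightarrow> finite (X u)" and card_X: "u \<in> U \<Longrightarrow> card (X u) = d - k u"
    and inj_X: "inj_on X U" and inj_y: "inj_on y U"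
    and y_notin_X: "u \<in> U \<Longrightarrow> v \<in> U \<Longrightarrow> y u \<notin> X v"
    and vars_bound: "u \<in> U \<Longrightarrow> insert (y u) (X u) \<subseteq> {..<n}"
begin

text \<open>The inclusion says that the factor of \<open>m\<close> without \<open>y u\<close> has
  the value 1 at the indicator vector of \<open>X u\<close>.\<close>

definition fits :: "(nat \<Rightarrow>\<^sub>0 nat) \<Rightarrow> 'u \<Rightarrow> nat \<Rightarrow> bool" where
  "fits m u a \<longleftrightarrow> u \<in> U \<and> Poly_Mapping.keys m \<subseteq> insert (y u) (X u) \<and> Poly_Mapping.lookup m (y u) = a"

text \<open>
  The functional evaluates the coefficient of \<open>y\<^sub>u\<^bsup>k\<^esup>\<close>, a form in the variables \<open>X\<close>, at the
  indicator vector of \<open>X u\<close>, and adds up over \<open>u\<close>.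
\<close>

definition c :: "(nat \<Rightarrow>\<^sub>0 nat) \<Rightarrow> 'k::field" where
  "c m = of_bool (mdeg m = d \<and> (\<exists>u. fits m u (k u)))"

text \<open>A filler variable, whose powers bring a monomial to the required degree.\<close>

definition x0 :: "'u \<Rightarrow> nat" where
  "x0 u = (SOME x. x \<in> X u)"

lemma x0_in_X: "u \<in> U \<Longrightarrow> x0 u \<in> X u"
proof -
  assume "u \<in> U"
  then have "card (X u) > 0" using card_X[of u] k_pos[of u] k_le[of u] by simp
  then have "X u \<noteq> {}" by auto
  then show ?thesis unfolding x0_def by (simp add: some_in_eq)
qed

lemma y_x0: "u \<in> U \<Longrightarrow> v \<in> U \<Longrightarrow> y u \<noteq> x0 v"
  using x0_in_X y_notin_X by metis

lemma y_in_insert: "u \<in> U \<Longrightarrow> v \<in> U \<Longrightarrow> y u \<in> insert (y v) (X v) \<longleftrightarrow> u = v"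
  using y_notin_X inj_y by (auto simp: inj_on_def)

text \<open>Sets for the same \<open>k\<close> have the same size. Among their indicator vectors,
  the product of all variables in \<open>X u\<close> is therefore nonzero only at that of
  \<open>X u\<close>.\<close>

lemma X_subset_imp_eq:
  assumes "u \<in> U" "v \<in> U" "k u = k v" "X u \<subseteq> X v"
  shows "u = v"
  using assms card_subset_eq[OF finite_X[OF assms(2)] assms(4)] card_X inj_X
  by (auto simp: inj_on_def)

sublocale dual_functional n d "c :: _ \<Rightarrow> 'k::field"
proof
  show "mdeg m = d" if "(c m :: 'k) \<noteq> 0" for m
    using that by (auto simp: c_def split: if_splits)
  show "Poly_Mapping.keys m \<subseteq> {..<n}" if m: "(c m :: 'k) \<noteq> 0" for m
  proof -
    obtain u where "fits m u (k u)" using m by (auto simp: c_def split: if_splits)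
    then show ?thesis using vars_bound[of u] by (auto simp: fits_def)
  qed
  obtain u where u: "u \<in> U" using U_nonempty by auto
  define m where "m = Poly_Mapping.single (y u) (k u) + Poly_Mapping.single (x0 u) (d - k u)"
  have "fits m u (k u)"
    using u x0_in_X[OF u] y_x0[OF u u]
    by (auto simp: fits_def m_def keys_add_nat lookup_add lookup_single)
  moreover have "mdeg m = d" using k_le[OF u] by (simp add: m_def)
  ultimately have "(c m :: 'k) \<noteq> 0" by (auto simp: c_def)
  then show "\<exists>m. (c m :: 'k) \<noteq> 0" by blast
qed

text \<open>At indicator vectors the value of a monomial depends only on its support. In degree
  below \<open>d - k u\<close> a support inside \<open>X u\<close> is one of these sets, so their
  number bounds the error.\<close>

definition proper :: "nat set set" where
  "proper = {S. \<exists>u\<in>U. S \<subset> X u}"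

lemma finite_proper: "finite proper"
proof (rule finite_subset)
  show "proper \<subseteq> (\<Union>u\<in>U. Pow (X u))" by (auto simp: proper_def)
  show "finite (\<Union>u\<in>U. Pow (X u))" using finite_U finite_X by auto
qed

text \<open>For \<open>k u = i\<close> the product of all variables in \<open>X u\<close> has degree
  \<open>d - i\<close>. If \<open>2 * i = d\<close> this is also \<open>i\<close>, and
  \<open>u\<close> is separated on both sides of the pairing.\<close>

definition weight :: "nat \<Rightarrow> nat" where
  "weight i = (if 2 * i = d then 2 else 1)"

text \<open>A split of the \<open>k u\<close>-th power of \<open>y u\<close> into two nontrivial
  powers identifies \<open>u\<close> by itself, which gives the first summand. In a trivial split
  the side without \<open>y u\<close> must separate the points by their \<open>X u\<close>, which
  gives the second.\<close>

definition main_term :: "nat \<Rightarrow> nat" where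
  "main_term i = (\<Sum>u\<in>U. min i (k u - 1) + (if k u = i then weight i else 0))"

context
  fixes i :: nat
  assumes i_pos: "1 \<le> i" and i_le: "2 * i \<le> d"
begin

definition exps :: "'u \<Rightarrow> nat set" where
  "exps u = {1..min i (k u - 1)} \<union> {a. k u = i \<and> (a = i \<or> a = 0 \<and> 2 * i = d)}"

lemma exps_cases:
  assumes "u \<in> U" "a \<in> exps u"
  obtains "1 \<le> a" "a \<le> i" "a < k u" | "a = i" "k u = i" | "a = 0" "k u = i" "2 * i = d"
  using assms k_pos[of u] by (fastforce simp: exps_def)

lemma card_exps:
  assumes "u \<in> U"
  shows "card (exps u) = min i (k u - 1) + (if k u = i then weight i else 0)"
proof -
  have "{a. k u = i \<and> (a = i \<or> a = 0 \<and> 2 * i = d)} =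
      (if k u = i then if 2 * i = d then {0, i} else {i} else {})"
    by auto
  moreover have "{1..min i (k u - 1)} \<inter> {a. k u = i \<and> (a = i \<or> a = 0 \<and> 2 * i = d)} = {}"
    using i_pos by auto
  ultimately show ?thesis
    unfolding exps_def using i_pos by (subst card_Un_disjoint) (auto simp: weight_def)
qed

text \<open>
  Dual bases up to the error: \<open>exps u\<close> lists the exponents of \<open>y\<^sub>u\<close> in the monomials of degree \<open>i\<close>
  that are used. The products of all variables in \<open>X u\<close> separate the points.
\<close>

definition left :: "'u \<times> nat \<Rightarrow> (nat \<Rightarrow>\<^sub>0 nat)" where
  "left = (\<lambda>(u, a). Poly_Mapping.single (y u) a +
     (if a = 0 then sqfree (X u) else Poly_Mapping.single (x0 u) (i - a)))"

definition right :: "'u \<times> nat \<Rightarrow> (nat \<Rightarrow>\<^sub>0 nat)" where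
  "right = (\<lambda>(u, a). Poly_Mapping.single (y u) (k u - a) +
     (if a = k u then sqfree (X u) else Poly_Mapping.single (x0 u) (d - i - (k u - a))))"

lemma mdeg_left:
  assumes "u \<in> U" "a \<in> exps u"
  shows "mdeg (left (u, a)) = i"
  using assms
proof (cases rule: exps_cases)
  case 3
  then show ?thesis
    using assms(1) by (simp add: left_def mdeg_sqfree finite_X card_X)
qed (use i_pos in \<open>simp_all add: left_def\<close>)

lemma mdeg_right:
  assumes "u \<in> U" "a \<in> exps u"
  shows "mdeg (right (u, a)) = d - i"
  using assms
proof (cases rule: exps_cases)
  case 1
  then have "k u - a + (d - i - (k u - a)) = d - i"
    using i_le k_le[OF assms(1)] by linarith
  then show ?thesis using 1 by (simp add: right_def)
next
  case 2
  then show ?thesis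
    using assms(1) by (simp add: right_def mdeg_sqfree finite_X card_X)
next
  case 3
  then show ?thesis using i_pos by (simp add: right_def)
qed

lemma lookup_left: "u \<in> U \<Longrightarrow> w \<in> U \<Longrightarrow>
    Poly_Mapping.lookup (left (u, a)) (y w) = (if w = u then a else 0)"
  using y_notin_X[of w u] y_x0[of w u] inj_y
  by (auto simp: left_def lookup_add lookup_single lookup_sqfree finite_X when_def inj_on_def)

lemma lookup_right: "u \<in> U \<Longrightarrow> w \<in> U \<Longrightarrow>
    Poly_Mapping.lookup (right (u, a)) (y w) = (if w = u then k u - a else 0)"
  using y_notin_X[of w u] y_x0[of w u] inj_y
  by (auto simp: right_def lookup_add lookup_single lookup_sqfree finite_X when_def inj_on_def)

lemma keys_left_right: "u \<in> U \<Longrightarrow> Poly_Mapping.keys (left (u, a)) \<subseteq> insert (y u) (X u)"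
  "u \<in> U \<Longrightarrow> Poly_Mapping.keys (right (u, a)) \<subseteq> insert (y u) (X u)"
  using x0_in_X[of u]
  by (auto simp: left_def right_def keys_add_nat keys_sqfree finite_X split: if_splits)

lemma pairing_diagonal:
  assumes "u \<in> U" "a \<in> exps u"
  shows "(c (right (u, a) + left (u, a)) :: 'k::field) \<noteq> 0"
proof -
  \<comment> \<open>Subtraction is truncated; this bound makes the exponents \<open>k u - a\<close>
    and \<open>a\<close> of \<open>y u\<close> add up to \<open>k u\<close>.\<close>
  have "a \<le> k u" using assms by (elim exps_cases) auto
  then have "fits (right (u, a) + left (u, a)) u (k u)"
    using assms keys_left_right[of u a]
    by (auto simp: fits_def keys_add_nat lookup_add lookup_left lookup_right)
  then show ?thesis
    using mdeg_left[OF assms] mdeg_right[OF assms] i_le by (auto simp: c_def)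
qed

text \<open>If \<open>u = u'\<close>, the exponents of the private variable force
  \<open>a = a'\<close>. Otherwise one factor carries the whole power of \<open>y w\<close> and the
  other is the product of all variables in its own \<open>X\<close>, so that
  \<open>X_subset_imp_eq\<close> applies.\<close>

lemma pairing_off_diagonal:
  assumes s: "u' \<in> U" "a' \<in> exps u'" and t: "u \<in> U" "a \<in> exps u" and ne: "(u', a') \<noteq> (u, a)"
  shows "(c (right (u, a) + left (u', a')) :: 'k::field) = 0"
proof (rule ccontr)
  assume "\<not> ?thesis"
  then obtain w where "fits (right (u, a) + left (u', a')) w (k w)"
    by (auto simp: c_def split: if_splits)
  then have w: "w \<in> U" and r: "Poly_Mapping.keys (right (u, a)) \<subseteq> insert (y w) (X w)"
    and l: "Poly_Mapping.keys (left (u', a')) \<subseteq> insert (y w) (X w)"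
    and sum: "Poly_Mapping.lookup (right (u, a)) (y w) + Poly_Mapping.lookup (left (u', a')) (y w) = k w"
    by (auto simp: fits_def keys_add_nat lookup_add)
  have le: "a \<le> k u" "a' \<le> k u'" using s t by (auto elim!: exps_cases)
  note sum = sum[unfolded lookup_left[OF s(1) w] lookup_right[OF t(1) w]]
  have r0: "w = u \<or> a = k u"
    using r lookup_right[OF t(1) t(1), of a] y_in_insert[OF t(1) w] le
    by (auto simp: in_keys_iff subset_eq)
  have l0: "w = u' \<or> a' = 0"
    using l lookup_left[OF s(1) s(1), of a'] y_in_insert[OF s(1) w]
    by (auto simp: in_keys_iff subset_eq)
  show False
  proof (cases "u = u'")
    case True
    then show False
      using sum le ne k_pos[OF w] by (auto split: if_splits)
  next
    case False
    then consider "w = u" "a = 0" "a' = 0" | "w = u'" "a' = k u'" "a = k u"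
      using sum le k_pos[OF w] r0 l0 by (fastforce split: if_splits)
    then show False
    proof cases
      case 1
      have "k u = i" "k u' = i"
        using s t 1 i_pos by (auto elim!: exps_cases)
      moreover have "X u' \<subseteq> X u"
        using l 1 y_notin_X[OF w s(1)] finite_X[OF s(1)]
        by (auto simp: left_def keys_add_nat keys_sqfree)
      ultimately show False using X_subset_imp_eq[OF s(1) t(1)] False by simp
    next
      case 2
      have "k u = i" "k u' = i"
        using s t 2 k_pos by (auto elim!: exps_cases)
      moreover have "X u \<subseteq> X u'"
        using r 2 y_notin_X[OF w t(1)] finite_X[OF t(1)]
        by (auto simp: right_def keys_add_nat keys_sqfree)
      ultimately show False using X_subset_imp_eq[OF t(1) s(1)] False by simp
    qed
  qed
qed

text \<open>The families correspond to the power \<open>b\<close> of a private variable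
  \<open>y v\<close> in the multiplier \<open>a\<close>: \<open>0 < b < k v\<close> leads to the
  first, \<open>b = k v\<close> to sums of the second, and no private variable to the third.\<close>

definition tests :: "((nat \<Rightarrow>\<^sub>0 nat) \<Rightarrow> 'k::field) set" where
  "tests =
     (\<lambda>(u, a) m. of_bool (fits m u a)) ` (SIGMA u:U. {1..min i (k u - 1)}) \<union>
     (\<lambda>S m. of_bool (Poly_Mapping.keys m = S)) ` (proper \<union> X ` {u\<in>U. k u = i \<and> 2 * i = d}) \<union>
     (\<lambda>S m. of_bool (\<exists>u. S \<subseteq> X u \<and> fits m u (k u))) ` (proper \<union> X ` {u\<in>U. k u = i})"

lemma finite_tests: "finite tests"
  using finite_U finite_proper by (auto simp: tests_def)

lemma card_tests: "card (tests :: (_ \<Rightarrow> 'k::field) set) \<le> main_term i + 2 * card proper"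
proof -
  let ?N = "{u\<in>U. k u = i}" and ?N' = "{u\<in>U. k u = i \<and> 2 * i = d}"
  have *: "card (f ` (proper \<union> X ` M)) \<le> card proper + card M" if "M \<subseteq> U"
    for f :: "nat set \<Rightarrow> (nat \<Rightarrow>\<^sub>0 nat) \<Rightarrow> 'k" and M
  proof -
    have M: "finite M" using that finite_U finite_subset by blast
    have "card (f ` (proper \<union> X ` M)) \<le> card (proper \<union> X ` M)"
      using finite_proper M by (intro card_image_le) auto
    also have "\<dots> \<le> card proper + card (X ` M)" by (rule card_Un_le)
    also have "card (X ` M) \<le> card M" using M by (rule card_image_le)
    finally show ?thesis by simp
  qed
  have "card (tests :: (_ \<Rightarrow> 'k) set) \<le>
      card (SIGMA u:U. {1..min i (k u - 1)}) + (card proper + card ?N') + (card proper + card ?N)"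
    unfolding tests_def
    by (intro order.trans[OF card_Un_le] add_mono * card_image_le) (auto simp: finite_U)
  also have "card (SIGMA u:U. {1..min i (k u - 1)}) = (\<Sum>u\<in>U. min i (k u - 1))"
    using finite_U by simp
  finally have "card (tests :: (_ \<Rightarrow> 'k) set) \<le>
      (\<Sum>u\<in>U. min i (k u - 1)) + (card ?N' + card ?N) + 2 * card proper"
    by simp
  moreover have "card ?N' + card ?N = (\<Sum>u\<in>U. if k u = i then weight i else 0)"
    using finite_U by (auto simp: weight_def sum.If_cases Int_def)
  ultimately show ?thesis by (simp add: main_term_def sum.distrib)
qed

lemma tests_kernel:
  assumes p: "p \<in> forms n i" and tests: "\<And>w. w \<in> tests \<Longrightarrow> lin w p = (0 :: 'k::field)"
  shows "p \<in> I"
proof -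
  have deg: "mdeg m = i" if "m \<in> Poly_Mapping.keys p" for m
    using p that by (auto simp: forms_def)
  have "lin (\<lambda>m. c (a + m)) p = 0" for a
  proof (cases "mdeg a = d - i")
    case False
    then have "c (a + m) = (0 :: 'k)" if "m \<in> Poly_Mapping.keys p" for m
      using deg[OF that] i_le by (auto simp: c_def)
    then show ?thesis by (rule lin_weight_zero)
  next
    case a: True
    have c: "c (a + m) = (of_bool (\<exists>u. fits (a + m) u (k u)) :: 'k)" if "m \<in> Poly_Mapping.keys p" for m
      using deg[OF that] i_le a by (auto simp: c_def)
    show ?thesis
    proof (cases "Poly_Mapping.keys a \<inter> y ` U = {}")
      case True
      have eq: "fits (a + m) u (k u) \<longleftrightarrow> Poly_Mapping.keys a \<subseteq> X u \<and> fits m u (k u)" for m u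
      proof (cases "u \<in> U")
        case u: True
        then have "y u \<notin> Poly_Mapping.keys a" using True by auto
        then show ?thesis
          using u by (auto simp: fits_def keys_add_nat lookup_add in_keys_iff)
      qed (simp add: fits_def)
      let ?w = "\<lambda>m. of_bool (\<exists>u. Poly_Mapping.keys a \<subseteq> X u \<and> fits m u (k u)) :: 'k"
      have "lin ?w p = 0"
      proof (cases "\<exists>u\<in>U. Poly_Mapping.keys a \<subseteq> X u \<and> k u \<le> i")
        case True
        then obtain u where u: "u \<in> U" "Poly_Mapping.keys a \<subseteq> X u" "k u \<le> i" by auto
        have "Poly_Mapping.keys a \<in> proper \<union> X ` {u\<in>U. k u = i}"
        proof (cases "Poly_Mapping.keys a = X u")
          case True
          \<comment> \<open>A support as large as \<open>X u\<close> needs degree at least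
            \<open>d - k u\<close>; with \<open>k u \<le> i\<close> this leaves only
            \<open>k u = i\<close>.\<close>
          then have "d - k u \<le> d - i"
            using card_keys_le_mdeg[of a] card_X[OF u(1)] a by simp
          then have "k u = i" using u i_le by linarith
          then show ?thesis using u True by auto
        next
          case False
          then show ?thesis using u by (auto simp: proper_def)
        qed
        then have "?w \<in> tests" unfolding tests_def by blast
        then show ?thesis by (rule tests)
      next
        case False
        \<comment> \<open>Every \<open>u\<close> whose \<open>X u\<close> contains the support of
          \<open>a\<close> now has \<open>k u > i\<close>, an exponent too large for a monomial of
          degree \<open>i\<close>.\<close>
        have "\<not> (Poly_Mapping.keys a \<subseteq> X u \<and> fits m u (k u))" if "m \<in> Poly_Mapping.keys p" for m u
          using False deg[OF that] lookup_le_mdeg[of m "y u"] by (auto simp: fits_def)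
        then show ?thesis by (intro lin_weight_zero) simp
      qed
      moreover have "lin (\<lambda>m. c (a + m)) p = lin ?w p"
        by (rule lin_weight_cong) (simp add: c eq)
      ultimately show ?thesis by simp
    next
      case False
      then obtain v where v: "v \<in> U" "y v \<in> Poly_Mapping.keys a" by auto
      define b where "b = Poly_Mapping.lookup a (y v)"
      have b: "1 \<le> b" using v by (simp add: b_def in_keys_iff)
      have uv: "fits (a + m) u (k u) \<Longrightarrow> u = v" for m u
        using v y_in_insert[of v u] by (auto simp: fits_def keys_add_nat)
      show ?thesis
      proof (cases "Poly_Mapping.keys a \<subseteq> insert (y v) (X v) \<and> b \<le> k v")
        case False
        then have "\<not> fits (a + m) v (k v)" for m
          by (auto simp: fits_def keys_add_nat lookup_add b_def)
        then have "\<not> fits (a + m) u (k u)" for m u using uv by blast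
        then show ?thesis by (intro lin_weight_zero) (simp add: c)
      next
        case True
        have "fits (a + m) v (k v) \<longleftrightarrow> fits m v (k v - b)" for m
          using True by (auto simp: fits_def keys_add_nat lookup_add b_def)
        then have "(\<exists>u. fits (a + m) u (k u)) \<longleftrightarrow> fits m v (k v - b)" for m
          using uv by blast
        then have eq: "lin (\<lambda>m. c (a + m)) p = lin (\<lambda>m. of_bool (fits m v (k v - b))) p"
          by (intro lin_weight_cong) (simp add: c)
        show ?thesis
        proof (cases "b = k v")
          case True
          \<comment> \<open>One test per \<open>v\<close> would cost as many tests as there are
            points. After splitting by support, the sets in \<open>proper\<close> suffice unless
            \<open>k v = i\<close> and \<open>2 * i = d\<close>.\<close>
          have "of_bool (fits m v 0) = (\<Sum>S\<in>Pow (X v). of_bool (Poly_Mapping.keys m = S) :: 'k)" for m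
          proof -
            have "fits m v 0 \<longleftrightarrow> Poly_Mapping.keys m \<in> Pow (X v)"
              using v y_notin_X[of v v] by (auto simp: fits_def in_keys_iff)
            then show ?thesis
              using finite_X[OF v(1)] by (simp add: of_bool_def sum.delta)
          qed
          moreover have "lin (\<lambda>m. of_bool (Poly_Mapping.keys m = S)) p = 0" if S: "S \<in> Pow (X v)" for S
          proof (cases "S \<in> proper \<union> X ` {u\<in>U. k u = i \<and> 2 * i = d}")
            case True
            then have "(\<lambda>m. of_bool (Poly_Mapping.keys m = S)) \<in> tests"
              unfolding tests_def by blast
            then show ?thesis by (rule tests)
          next
            case False
            have "S = X v" using S False v by (auto simp: proper_def)
            \<comment> \<open>As \<open>k v\<close> and \<open>i\<close> are at most half of
              \<open>d\<close>, the inequality would force \<open>k v = i\<close> and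
              \<open>2 * i = d\<close>, where \<open>X v\<close> has its own test.\<close>
            moreover have "\<not> d - k v \<le> i"
              using False v k_le[OF v(1)] i_le \<open>S = X v\<close> by auto
            ultimately have "Poly_Mapping.keys m \<noteq> S" if "m \<in> Poly_Mapping.keys p" for m
              using card_keys_le_mdeg[of m] deg[OF that] card_X[OF v(1)] by auto
            then show ?thesis by (intro lin_weight_zero) simp
          qed
          ultimately show ?thesis
            unfolding eq True by (simp add: lin_weight_sum)
        next
          case False
          then have bk: "b < k v" using True by simp
          show ?thesis
          proof (cases "k v - b \<le> i")
            case True
            then have "(v, k v - b) \<in> (SIGMA u:U. {1..min i (k u - 1)})"
              using v b bk by auto
            then have "(\<lambda>(u, a) m. of_bool (fits m u a) :: 'k) (v, k v - b) \<in> tests"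
              unfolding tests_def by blast
            then show ?thesis
              unfolding eq by (intro tests) simp
          next
            case False
            then have "\<not> fits m v (k v - b)" if "m \<in> Poly_Mapping.keys p" for m
              using deg[OF that] lookup_le_mdeg[of m "y v"] by (auto simp: fits_def)
            then show ?thesis unfolding eq by (intro lin_weight_zero) simp
          qed
        qed
      qed
    qed
  qed
  then show ?thesis using p by (intro I_memI) (simp_all add: forms_def)
qed

lemma hilbert_function_main:
  shows "main_term i \<le> hilbert_function n (I :: 'k::field mpoly set) i"
    and "hilbert_function n (I :: 'k mpoly set) i \<le> main_term i + 2 * card proper"
proof -
  have fin: "finite (SIGMA u:U. exps u)"
    using finite_U by (auto simp: exps_def)
  note bounds = hilbert_function_bounds[where 'k = 'k, OF fin finite_tests tests_kernel,
      where u = left and v = right]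
  have "card (SIGMA u:U. exps u) = main_term i"
    using finite_U card_exps by (simp add: main_term_def exps_def)
  moreover have "card (SIGMA u:U. exps u) \<le> hilbert_function n (I :: 'k mpoly set) i"
    by (rule bounds(1)) (auto simp: mdeg_left pairing_diagonal intro!: pairing_off_diagonal)
  moreover have "hilbert_function n (I :: 'k mpoly set) i \<le> card (tests :: (_ \<Rightarrow> 'k) set)"
    by (rule bounds(2)) (auto simp: mdeg_left pairing_diagonal intro!: pairing_off_diagonal)
  ultimately show "main_term i \<le> hilbert_function n (I :: 'k mpoly set) i"
    "hilbert_function n (I :: 'k mpoly set) i \<le> main_term i + 2 * card proper"
    using card_tests[where 'k = 'k] by auto
qed

end

end

section \<open>Prescribing the order of the Hilbert function\<close>

text \<open>
  The equation at \<open>i\<close> involves \<open>t k\<close> only for \<open>k \<ge> i\<close>, so it is solved downwards from \<open>d div 2\<close>.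
  Evenness is needed at \<open>2 * i = d\<close>.
\<close>

lemma multiplicities_exist:
  fixes w :: "nat \<Rightarrow> nat"
  assumes even: "\<And>i. even (w i)"
  shows "\<exists>t. \<forall>i\<in>{1..d div 2}. (if 2 * i = d then 2 else 1) * t i =
    w i + (\<Sum>k\<in>{i<..d div 2}. t k * (k - 1 - i))"
proof -
  \<comment> \<open>Here \<open>r\<close> counts the topmost equations already solved.\<close>
  have "\<exists>t. \<forall>i\<in>{Suc (d div 2) - r..d div 2}. (if 2 * i = d then 2 else 1) * t i =
      w i + (\<Sum>k\<in>{i<..d div 2}. t k * (k - 1 - i))" for r
  proof (induction r)
    case (Suc r)
    then obtain t where t: "\<And>i. i \<in> {Suc (d div 2) - r..d div 2} \<Longrightarrow>
      (if 2 * i = d then 2 else 1) * t i = w i + (\<Sum>k\<in>{i<..d div 2}. t k * (k - 1 - i))"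
      by blast
    show ?case
    proof (cases "r \<le> d div 2")
      case False
      then have "Suc (d div 2) - Suc r = Suc (d div 2) - r" by simp
      then show ?thesis using t by (intro exI[of _ t]) simp
    next
      case True
      define j where "j = d div 2 - r"
      define s where "s = w j + (\<Sum>k\<in>{j<..d div 2}. t k * (k - 1 - j))"
      define t' where "t' = t(j := s div (if 2 * j = d then 2 else 1))"
      have sum: "(\<Sum>k\<in>{i<..d div 2}. t' k * (k - 1 - i)) = (\<Sum>k\<in>{i<..d div 2}. t k * (k - 1 - i))"
        if "i \<ge> j" for i
        using that by (intro sum.cong) (auto simp: t'_def)
      \<comment> \<open>If \<open>2 * j = d\<close>, the sum in \<open>s\<close> is empty and
        \<open>s = w j\<close> is even, so the division is exact.\<close>
      have s: "(if 2 * j = d then 2 else 1) * t' j = s"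
        using even[of j] by (auto simp: t'_def s_def)
      have "(if 2 * i = d then 2 else 1) * t' i = w i + (\<Sum>k\<in>{i<..d div 2}. t' k * (k - 1 - i))"
        if i: "i \<in> {j..d div 2}" for i
      proof (cases "i = j")
        case True
        then show ?thesis using s sum[of j] by (simp add: s_def)
      next
        case False
        then have "i \<in> {Suc (d div 2) - r..d div 2}" using i by (auto simp: j_def)
        then show ?thesis using t[of i] sum[of i] i False by (simp add: t'_def)
      qed
      moreover have "Suc (d div 2) - Suc r = j" by (simp add: j_def)
      ultimately show ?thesis by (intro exI[of _ t']) simp
    qed
  qed simp
  from this[of "d div 2"] show ?thesis by simp
qed

text \<open>With truncated subtraction, \<open>k - 1 = min i (k - 1) + (k - 1 - i)\<close>. The
  terms \<open>k - 1 - i\<close> are what the minimum loses against a constant, and the bump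
  \<open>\<mu> * t i\<close> makes up for them with surplus \<open>w i\<close>.\<close>

lemma sum_multiplicities:
  fixes t w :: "nat \<Rightarrow> nat"
  assumes i: "i \<in> {1..N}" and t: "\<mu> * t i = w i + (\<Sum>k\<in>{i<..N}. t k * (k - 1 - i))"
  shows "(\<Sum>k\<in>{1..N}. t k * (min i (k - 1) + (if k = i then \<mu> else 0))) =
    (\<Sum>k\<in>{1..N}. t k * (k - 1)) + w i"
proof -
  have "(\<Sum>k\<in>{1..N}. t k * (k - 1)) =
      (\<Sum>k\<in>{1..N}. t k * min i (k - 1) + t k * (k - 1 - i))"
    by (intro sum.cong) (auto simp: min_def simp flip: distrib_left)
  also have "\<dots> = (\<Sum>k\<in>{1..N}. t k * min i (k - 1)) + (\<Sum>k\<in>{1..N}. t k * (k - 1 - i))"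
    by (rule sum.distrib)
  also have "(\<Sum>k\<in>{1..N}. t k * (k - 1 - i)) = (\<Sum>k\<in>{i<..N}. t k * (k - 1 - i))"
    by (rule sum.mono_neutral_right) auto
  finally have "(\<Sum>k\<in>{1..N}. t k * (k - 1)) + w i = (\<Sum>k\<in>{1..N}. t k * min i (k - 1)) + \<mu> * t i"
    using t by simp
  also have "\<mu> * t i = (\<Sum>k\<in>{1..N}. t k * (if k = i then \<mu> else 0))"
    using i by (simp add: if_distrib sum.delta cong: if_cong)
  finally show ?thesis by (simp add: distrib_left sum.distrib)
qed

section \<open>Grids as point configurations, and the count of proper subsets\<close>

locale grid =
  fixes d m :: nat and t :: "nat \<Rightarrow> nat"
  assumes m_pos: "m \<ge> 1" and t_pos: "\<exists>k\<in>{1..d div 2}. t k \<ge> 1"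
begin

text \<open>
  Stretching the first side equalises the sizes of the grids: the one for \<open>k\<close> has
  \<open>t k * m ^ d\<close> points, whatever its dimension \<open>d - k\<close>.
\<close>

definition side :: "nat \<Rightarrow> nat \<Rightarrow> nat" where
  "side k j = (if j = 0 then t k * m ^ (k + 1) else m)"

definition points :: "nat \<Rightarrow> (nat \<Rightarrow> nat) set" where
  "points k = (\<Pi>\<^sub>E j\<in>{..<d - k}. {..<side k j})"

definition U :: "(nat \<times> (nat \<Rightarrow> nat)) set" where
  "U = (SIGMA k:{1..d div 2}. points k)"

text \<open>The set \<open>X (k, f)\<close> becomes a coded graph of the point \<open>f\<close>,
  tagged by its grid \<open>k\<close>. Even numbers leave the odd ones to \<open>y\<close>.\<close>

definition x_var :: "nat \<Rightarrow> (nat \<Rightarrow> nat) \<Rightarrow> nat \<Rightarrow> nat" where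
  "x_var k f j = 2 * prod_encode (k, prod_encode (j, f j))"

definition X :: "nat \<times> (nat \<Rightarrow> nat) \<Rightarrow> nat set" where
  "X = (\<lambda>(k, f). x_var k f ` {..<d - k})"

definition idx :: "nat \<times> (nat \<Rightarrow> nat) \<Rightarrow> nat" where
  "idx = (SOME g. inj_on g U)"

definition y :: "nat \<times> (nat \<Rightarrow> nat) \<Rightarrow> nat" where
  "y u = 2 * idx u + 1"

definition n :: nat where
  "n = (SOME n. (\<Union>u\<in>U. insert (y u) (X u)) \<subseteq> {..<n})"

lemma finite_points: "finite (points k)"
  by (auto simp: points_def intro: finite_PiE)

lemma prod_side:
  assumes "k \<in> {1..d div 2}"
  shows "(\<Prod>j<d - k. side k j) = t k * m ^ d"
proof -
  have dk: "d - k = Suc (d - k - 1)" using assms by auto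
  have "(\<Prod>j<d - k. side k j) = t k * m ^ (k + 1) * m ^ (d - k - 1)"
    by (subst dk, subst prod.lessThan_Suc_shift) (simp add: side_def)
  also have "\<dots> = t k * m ^ (k + 1 + (d - k - 1))"
    by (simp only: power_add mult.assoc)
  also have "k + 1 + (d - k - 1) = d" using assms by auto
  finally show ?thesis .
qed

lemma card_points: "k \<in> {1..d div 2} \<Longrightarrow> card (points k) = t k * m ^ d"
  by (simp add: points_def card_PiE prod_side)

lemma inj_x_var: "inj_on (x_var k f) A"
  by (auto simp: inj_on_def x_var_def)

lemma finite_U: "finite U"
  by (auto simp: U_def finite_points)

lemma inj_idx: "inj_on idx U"
proof -
  obtain g :: "nat \<times> (nat \<Rightarrow> nat) \<Rightarrow> nat" where "inj_on g U"
    using finite_imp_inj_to_nat_seg[OF finite_U] by blast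
  then show ?thesis unfolding idx_def by (rule someI[of "\<lambda>g. inj_on g U"])
qed

lemma vars_subset: "(\<Union>u\<in>U. insert (y u) (X u)) \<subseteq> {..<n}"
proof -
  have "finite (\<Union>u\<in>U. insert (y u) (X u))"
    using finite_U by (auto simp: X_def)
  then obtain N where "(\<Union>u\<in>U. insert (y u) (X u)) \<subseteq> {..<N}"
    using finite_nat_iff_bounded by blast
  then show ?thesis unfolding n_def by (rule someI[of "\<lambda>N. (\<Union>u\<in>U. insert (y u) (X u)) \<subseteq> {..<N}"])
qed

lemma inj_X: "inj_on X U"
proof (rule inj_onI)
  fix u v assume "u \<in> U" "v \<in> U" and eq: "X u = X v"
  then obtain k f l g where u: "u = (k, f)" "k \<in> {1..d div 2}" "f \<in> points k"
    and v: "v = (l, g)" "l \<in> {1..d div 2}" "g \<in> points l"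
    by (auto simp: U_def)
  \<comment> \<open>Coordinate 0 exists since \<open>k < d\<close>, and its variable reveals the
    tag.\<close>
  have "x_var k f 0 \<in> X v" using u eq by (auto simp: X_def)
  then have kl: "k = l" using v by (auto simp: X_def x_var_def)
  have "f = g"
  proof (rule PiE_ext)
    show "f \<in> (\<Pi>\<^sub>E j\<in>{..<d - k}. {..<side k j})" "g \<in> (\<Pi>\<^sub>E j\<in>{..<d - k}. {..<side k j})"
      using u v kl by (auto simp: points_def)
    fix j assume "j \<in> {..<d - k}"
    then have "x_var k f j \<in> X v" using u eq by (auto simp: X_def)
    then show "f j = g j" using v by (auto simp: X_def x_var_def)
  qed
  then show "u = v" using u v kl by simp
qed

sublocale point_config n d U fst X y
proof
  show "finite U" by (rule finite_U)
  obtain k where k: "k \<in> {1..d div 2}" "t k \<ge> 1" using t_pos by auto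
  then have "card (points k) > 0" using m_pos by (simp add: card_points)
  then obtain f where "f \<in> points k" by (auto simp: card_gt_0_iff)
  then have "(k, f) \<in> U" using k by (auto simp: U_def)
  then show "U \<noteq> {}" by blast
  show "1 \<le> fst u" "2 * fst u \<le> d" "finite (X u)" "card (X u) = d - fst u" if "u \<in> U" for u
    using that by (auto simp: U_def X_def card_image inj_x_var)
  show "inj_on X U" by (rule inj_X)
  show "inj_on y U" using inj_idx by (auto simp: inj_on_def y_def)
  show "y u \<notin> X v" for u v
    by (auto simp: y_def X_def x_var_def) presburger
  show "insert (y u) (X u) \<subseteq> {..<n}" if "u \<in> U" for u
    using vars_subset that by blast
qed

lemma main_term_eq:
  "main_term i = m ^ d * (\<Sum>k\<in>{1..d div 2}. t k * (min i (k - 1) + (if k = i then weight i else 0)))"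
proof -
  have "main_term i = (\<Sum>k\<in>{1..d div 2}. \<Sum>f\<in>points k. min i (k - 1) + (if k = i then weight i else 0))"
    unfolding main_term_def unfolding U_def by (subst sum.Sigma) (auto simp: finite_points split_def)
  then show ?thesis
    by (simp add: card_points sum_distrib_left mult_ac)
qed

text \<open>Each side is at least \<open>m\<close> because \<open>t k \<ge> 1\<close>, so omitting a
  coordinate loses at least a factor \<open>m\<close> against the full grid.\<close>

lemma prod_side_proper:
  assumes k: "k \<in> {1..d div 2}" and J: "J \<subset> {..<d - k}" and "t k \<ge> 1"
  shows "m * (\<Prod>j\<in>J. side k j) \<le> t k * m ^ d"
proof -
  have side: "m \<le> side k j" for j
  proof -
    have "m * 1 \<le> m * (t k * m ^ k)"
      using assms(3) m_pos by (intro mult_left_mono) (simp_all add: Suc_le_eq)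
    then show ?thesis by (simp add: side_def mult_ac)
  qed
  obtain j where j: "j \<in> {..<d - k} - J" using J by blast
  have "1 * m \<le> (\<Prod>i\<in>{..<d - k} - J - {j}. side k i) * side k j"
    using side m_pos by (intro mult_mono prod_ge_1) (auto intro: order.trans)
  also have "\<dots> = (\<Prod>i\<in>{..<d - k} - J. side k i)"
    using j by (subst mult.commute, subst prod.remove[of _ j]) auto
  finally have "m * (\<Prod>j\<in>J. side k j) \<le> (\<Prod>i\<in>{..<d - k} - J. side k i) * (\<Prod>j\<in>J. side k j)"
    by (intro mult_right_mono) auto
  also have "\<dots> = (\<Prod>j<d - k. side k j)"
    using J by (intro prod.subset_diff[symmetric]) auto
  finally show ?thesis using prod_side[OF k] by simp
qed

text \<open>A proper subset of a graph is the graph of a partial point, given by \<open>k\<close>, a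
  proper set \<open>J\<close> of coordinates and the values on \<open>J\<close>. There are at most
  \<open>2 ^ d\<close> choices of \<open>J\<close>, each contributing at most a fraction
  \<open>1 / m\<close> of the grid.\<close>

lemma card_proper: "m * card proper \<le> 2 ^ d * (\<Sum>k\<in>{1..d div 2}. t k) * m ^ d"
proof -
  \<comment> \<open>The case \<open>t k = 0\<close> is left out: the grid is empty, but partial
    points could still exist while the bound \<open>t k * m ^ d\<close> is zero.\<close>
  define P where "P k = (if t k = 0 then {} else {J. J \<subset> {..<d - k}})" for k
  define F where "F k J = (\<lambda>g. x_var k g ` J) ` (\<Pi>\<^sub>E j\<in>J. {..<side k j})" for k J
  have finite_P: "finite (P k)" for k
    by (rule finite_subset[of _ "Pow {..<d - k}"]) (auto simp: P_def)
  have sub: "proper \<subseteq> (\<Union>k\<in>{1..d div 2}. \<Union>J\<in>P k. F k J)"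
  proof
    fix S assume "S \<in> proper"
    then obtain u where u: "u \<in> U" "S \<subset> X u"
      unfolding proper_def by blast
    obtain k f where "u = (k, f)" by fastforce
    then have kf: "k \<in> {1..d div 2}" "f \<in> points k" and S: "S \<subset> x_var k f ` {..<d - k}"
      using u by (simp_all add: U_def X_def)
    then obtain J where J: "J \<subseteq> {..<d - k}" "S = x_var k f ` J"
      by (auto simp: psubset_eq elim: subset_imageE)
    have "t k \<noteq> 0"
      using kf card_points[of k] finite_points[of k] by (cases "t k = 0") auto
    then have "J \<in> P k" using J S by (auto simp: P_def)
    moreover have "S = x_var k (restrict f J) ` J"
      unfolding J(2) by (rule image_cong) (auto simp: x_var_def)
    moreover have "restrict f J \<in> (\<Pi>\<^sub>E j\<in>J. {..<side k j})"
      using kf(2) J(1) by (auto simp: points_def)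
    ultimately show "S \<in> (\<Union>k\<in>{1..d div 2}. \<Union>J\<in>P k. F k J)"
      using kf(1) unfolding F_def by blast
  qed
  have J: "finite J" if "J \<in> P k" for k J
    using that finite_subset[of J "{..<d - k}"] by (auto simp: P_def split: if_splits)
  have card_F: "finite (F k J) \<and> m * card (F k J) \<le> t k * m ^ d"
    if k: "k \<in> {1..d div 2}" and JP: "J \<in> P k" for k J
  proof -
    have fin: "finite (\<Pi>\<^sub>E j\<in>J. {..<side k j})"
      using J[OF JP] by (intro finite_PiE) auto
    have "card (F k J) \<le> (\<Prod>j\<in>J. side k j)"
      unfolding F_def using card_image_le[OF fin] by (simp add: card_PiE[OF J[OF JP]])
    then have "m * card (F k J) \<le> m * (\<Prod>j\<in>J. side k j)" by simp
    also have "\<dots> \<le> t k * m ^ d"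
      using JP k by (intro prod_side_proper) (auto simp: P_def split: if_splits)
    finally show ?thesis unfolding F_def using fin by simp
  qed
  have card_P: "card (P k) \<le> 2 ^ d" for k
  proof -
    have "card (P k) \<le> card (Pow {..<d - k})"
      by (rule card_mono) (auto simp: P_def)
    also have "\<dots> \<le> 2 ^ d" by (simp add: card_Pow)
    finally show ?thesis .
  qed
  have "card proper \<le> card (\<Union>k\<in>{1..d div 2}. \<Union>J\<in>P k. F k J)"
    using card_F finite_P by (intro card_mono sub) auto
  also have "\<dots> \<le> (\<Sum>k\<in>{1..d div 2}. card (\<Union>J\<in>P k. F k J))"
    by (rule card_UN_le) simp
  also have "\<dots> \<le> (\<Sum>k\<in>{1..d div 2}. \<Sum>J\<in>P k. card (F k J))"
    by (intro sum_mono card_UN_le finite_P)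
  finally have "m * card proper \<le> m * (\<Sum>k\<in>{1..d div 2}. \<Sum>J\<in>P k. card (F k J))"
    by (rule mult_le_mono2)
  also have "\<dots> = (\<Sum>k\<in>{1..d div 2}. \<Sum>J\<in>P k. m * card (F k J))"
    by (simp only: sum_distrib_left)
  also have "\<dots> \<le> (\<Sum>k\<in>{1..d div 2}. \<Sum>J\<in>P k. t k * m ^ d)"
    using card_F by (intro sum_mono) auto
  also have "\<dots> \<le> (\<Sum>k\<in>{1..d div 2}. 2 ^ d * (t k * m ^ d))"
    using card_P by (intro sum_mono) (simp add: mult_right_mono)
  finally show ?thesis by (simp add: sum_distrib_left sum_distrib_right mult_ac)
qed

end

theorem theorem1p1:
  fixes d :: nat and \<pi> :: "nat \<Rightarrow> nat"
  assumes "d > 0" and "\<pi> permutes {1..d div 2}"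
  shows "\<exists>(n :: nat) (I :: ('k::field_char_0) mpoly set) (h :: nat \<Rightarrow> nat).
    homogeneous_ideal n I \<and>
    artinian_gorenstein n I \<and>
    has_socle_degree n I d \<and>
    hilbert_series n I = fps_of_poly (\<Sum>i=0..d. Polynomial.monom (h i) i) \<and>
    (\<forall>j \<in> {1..<d div 2}. h (\<pi> j) < h (\<pi> (j + 1)))"
proof (cases "d div 2 = 0")
  case True
  \<comment> \<open>Here \<open>d = 1\<close> and the order condition is empty, so the functional
    dual to a power of one variable suffices.\<close>
  interpret dual_functional 1 d "\<lambda>m. of_bool (m = Poly_Mapping.single 0 d) :: 'k"
    by unfold_locales (auto split: if_splits)
  have "\<forall>j\<in>{1..<d div 2}. hilbert_function 1 I (\<pi> j) < hilbert_function 1 I (\<pi> (j + 1))"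
    unfolding True by simp
  then show ?thesis
    using homogeneous_ideal_I artinian_gorenstein_I has_socle_degree_I hilbert_series_I by blast
next
  case False
  \<comment> \<open>Twice the position of \<open>i\<close> in the prescribed order; the factor 2
    supplies the evenness.\<close>
  define w where "w i = 2 * inv_into UNIV \<pi> i" for i
  have "\<And>i. even (w i)" by (simp add: w_def)
  from multiplicities_exist[of w, OF this, of d] obtain t where t: "\<And>i. i \<in> {1..d div 2} \<Longrightarrow>
      (if 2 * i = d then 2 else 1) * t i = w i + (\<Sum>k\<in>{i<..d div 2}. t k * (k - 1 - i))"
    by blast
  define C where "C = (\<Sum>k\<in>{1..d div 2}. t k * (k - 1))"
  \<comment> \<open>Large enough for the error \<open>2 * card proper\<close> to stay below
    \<open>m ^ d\<close>.\<close>
  define m where "m = 2 ^ (d + 1) * (\<Sum>k\<in>{1..d div 2}. t k) + 1"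
  have D: "d div 2 \<in> {1..d div 2}" using False by simp
  have "inv_into UNIV \<pi> (d div 2) \<in> {1..d div 2}"
    using permutes_in_image[OF permutes_inv[OF assms(2)]] D by blast
  \<comment> \<open>At the top index the sum is empty and \<open>w\<close> is positive, so at least
    this grid has points.\<close>
  then have "t (d div 2) \<ge> 1"
    using t[OF D] by (auto simp: w_def Suc_le_eq intro!: gr0I)
  then interpret grid d m t
    using D by unfold_locales (auto simp: m_def)
  define h where "h = hilbert_function n (I :: 'k mpoly set)"
  have main: "main_term i = m ^ d * (C + w i)" if "i \<in> {1..d div 2}" for i
    using sum_multiplicities[OF that, of "weight i" t w] t[OF that]
    by (simp add: main_term_eq C_def weight_def)
  have h: "m ^ d * (C + w i) \<le> h i" "h i \<le> m ^ d * (C + w i) + 2 * card proper"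
    if "i \<in> {1..d div 2}" for i
    using hilbert_function_main[of i, where 'k = 'k] main[OF that] that by (auto simp: h_def)
  have "m * (2 * card proper) \<le> 2 ^ (d + 1) * (\<Sum>k\<in>{1..d div 2}. t k) * m ^ d"
    using card_proper by simp
  also have "\<dots> < m * m ^ d" by (intro mult_strict_right_mono) (simp_all add: m_def)
  finally have small: "2 * card proper < m ^ d" by simp
  have "h (\<pi> j) < h (\<pi> (j + 1))" if j: "j \<in> {1..<d div 2}" for j
  proof -
    have \<pi>: "\<pi> j \<in> {1..d div 2}" "\<pi> (j + 1) \<in> {1..d div 2}"
      using j permutes_in_image[OF assms(2)] by auto
    have w: "w (\<pi> j) = 2 * j" "w (\<pi> (j + 1)) = 2 * j + 2"
      by (simp_all add: w_def permutes_inverses[OF assms(2)])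
    \<comment> \<open>Consecutive main terms differ by \<open>2 * m ^ d\<close>, which exceeds the
      error.\<close>
    have "h (\<pi> j) < m ^ d * (C + 2 * j) + m ^ d"
      using h(2)[OF \<pi>(1)] small w by simp
    also have "\<dots> \<le> m ^ d * (C + (2 * j + 2))" by (simp add: algebra_simps)
    also have "\<dots> \<le> h (\<pi> (j + 1))" using h(1)[OF \<pi>(2)] w by simp
    finally show ?thesis .
  qed
  then show ?thesis
    unfolding h_def
    using homogeneous_ideal_I artinian_gorenstein_I has_socle_degree_I hilbert_series_I by blast
qed

end
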